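(* For every $r \ge 4$ there exists a value $n_1(r)$ such that for all $n > n_1(r)$ and every biconnected digraph $D$ of order $n$ with outradius $r$, we have $\lvert A(D)\rvert \le \lvert A(D_{n,r,1})\rvert = (n-(r-1))^2+(r-3)$, with equality if and only if $D \cong D_{n,r,s}$ for some integer $s$ with $1 \le s \le \frac{n-2r+2}{2}$.
   Context: Digraphs are finite, without loops or multiple arcs; $A(D)$ is the arc set. $d(u,v)$ is the length of a shortest directed path from $u$ to $v$ ($+\infty$ if none). The outradius is $\min_v \max_u d(v,u)$. A digraph is biconnected (strongly connected) if all distances are finite. For $r\ge1$, $D_{2r,r,1}$ has vertex set $\{v_1,\dots,v_r\}\cup\{w_1,\dots,w_r\}$ and arcs $\{\vec{v_iv_j} : i\ne j,\ i\ge j-1\}\cup\{\vec{w_iw_j}: i\ne j,\ i\ge j-1\}\cup\{\vec{v_iw_1}:1\le i\le r\}\cup\{\vec{w_iv_1}:1\le i\le r\}$. For $n\ge 2r$ and $1\le s\le\frac{n-2r+2}{2}$, $D_{n,r,s}$ is obtained from $D_{2r,r,1}$ by replacing $v_1$ by a bidirected clique on $s$ vertices and $w_1$ by a bidirected clique on $n-2r+2-s$ vertices, where each new vertex inherits all arcs (with their directions) of the vertex it replaces, and all vertices of the two cliques are joined in both directions. *)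

theory Defs
  imports "Graph_Theory.Graph_Theory"
begin

definition distance :: "('a, 'b) pre_digraph \<Rightarrow> 'a \<Rightarrow> 'a \<Rightarrow> ereal" where
  "distance G u v = wf_digraph.\<mu> G (\<lambda>_. 1) u v"

definition outradius :: "('a, 'b) pre_digraph \<Rightarrow> ereal" where
  "outradius G = (INF v\<in>verts G. SUP u\<in>verts G. distance G v u)"

datatype vertex = V nat | W nat

(* The digraph D_{2r,r,1}, on {v_1, ..., v_r} and {w_1, ..., w_r}. *)
definition base_digraph :: "nat \<Rightarrow> vertex pair_pre_digraph" where
  "base_digraph r = \<lparr>
     pverts = V ` {1..r} \<union> W ` {1..r},
     parcs = {(V i, V j) | i j. i \<in> {1..r} \<and> j \<in> {1..r} \<and> i \<noteq> j \<and> j \<le> i + 1}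
           \<union> {(W i, W j) | i j. i \<in> {1..r} \<and> j \<in> {1..r} \<and> i \<noteq> j \<and> j \<le> i + 1}
           \<union> {(V i, W 1) | i. i \<in> {1..r}}
           \<union> {(W i, V 1) | i. i \<in> {1..r}} \<rparr>"

(* Every vertex x is replaced by a bidirected clique on the m x copies (x, 0), ..., (x, m x - 1),
   each of which inherits all arcs of x; m x = 1 leaves x unchanged. *)
definition blow_up :: "('a \<Rightarrow> nat) \<Rightarrow> 'a pair_pre_digraph \<Rightarrow> ('a \<times> nat) pair_pre_digraph" where
  "blow_up m G = \<lparr>
     pverts = {(x, k). x \<in> pverts G \<and> k < m x},
     parcs = {((x, k), (y, l)) | x k y l. x \<in> pverts G \<and> k < m x \<and> y \<in> pverts G \<and> l < m y \<and>
                ((x, y) \<in> parcs G \<or> (x = y \<and> k \<noteq> l))} \<rparr>"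

(* D_{n,r,s}, meaningful for r >= 1, n >= 2 r and 1 <= s <= (n - 2 r + 2) / 2. The copies of
   v_1 and w_1 are joined in both directions, since v_1 w_1 and w_1 v_1 are arcs of the base. *)
definition extremal :: "nat \<Rightarrow> nat \<Rightarrow> nat \<Rightarrow> (vertex \<times> nat) pair_pre_digraph" where
  "extremal n r s = blow_up ((\<lambda>_. 1)(V 1 := s, W 1 := n - 2 * r + 2 - s)) (base_digraph r)"

end

theory Submission
  imports Defs
begin

text \<open>
  Count missing arcs (ordered pairs of distinct nonadjacent vertices). A digraph at least as
  large as the extremal one misses at most \<open>(2r - 3) n\<close> arcs, so all but few vertices \<open>c\<close> miss
  few arcs in both directions. For such a \<open>c\<close>, take a geodesic from \<open>c\<close> to a farthest vertex, let \<open>u\<close>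
  be its vertex at distance \<open>r - 1\<close> from the end, and take a geodesic from \<open>c\<close> to a vertex \<open>b\<close>
  with \<open>d(u, b) \<ge> r\<close>: the two geodesics are disjoint beyond \<open>u\<close>, and together with the vertices
  between \<open>u\<close> and \<open>c\<close> they account for \<open>2r - 3\<close> arcs missing at \<open>c\<close>, and for more if an
  exceptional vertex misses \<open>c\<close>. Hence every vertex has arcs to all but a small fraction of the
  vertices, and its distance is at most 2 to all vertices outside the set \<open>T\<close> of vertices of small in-degree, which has at most
  \<open>2r - 3\<close> elements.

  The layers of \<open>T\<close>, measured by distance from outside \<open>T\<close>, then consist of two disjoint chains.
  Unless the deficits of the single vertices already exceed the bound, the ends \<open>a\<close>, \<open>b\<close> of the two
  chains are such that every vertex has distance at least \<open>r\<close> to \<open>a\<close> or to \<open>b\<close>. Counting the pairs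
  \<open>(x, z)\<close> with \<open>d(x, a) \<ge> d(z, a) + 2\<close> or \<open>d(x, b) \<ge> d(z, b) + 2\<close> gives the exact bound, and in the case
  of equality the distances to \<open>a\<close> and \<open>b\<close> determine the digraph.
\<close>

section \<open>Distances and missing arcs\<close>

text \<open>Arcs are a plain relation and distances natural numbers. The value is meaningful only
  when \<open>y\<close> is reachable from \<open>x\<close>, which holds throughout the locales
  below.\<close>

definition gdist :: "('a \<times> 'a) set \<Rightarrow> 'a \<Rightarrow> 'a \<Rightarrow> nat" where
  "gdist E x y = (LEAST k. (x, y) \<in> E ^^ k)"

text \<open>The number of ordered pairs of distinct vertices of D_{n,r,s} that are not arcs; it does
  not depend on \<open>s\<close>.\<close>

definition extremal_missing :: "nat \<Rightarrow> nat \<Rightarrow> int" where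
  "extremal_missing n r = (2 * int r - 3) * int n - (int r - 2) * (int r + 1)"

lemma gdist_le: "(x, y) \<in> E ^^ k \<Longrightarrow> gdist E x y \<le> k"
  unfolding gdist_def by (rule Least_le)

lemma relpow_gdist: "(x, y) \<in> E\<^sup>* \<Longrightarrow> (x, y) \<in> E ^^ gdist E x y"
  unfolding gdist_def rtrancl_power by (rule LeastI_ex)

lemma ex_maximum:
  fixes f :: "'a \<Rightarrow> nat"
  assumes "finite A" "A \<noteq> {}"
  shows "\<exists>a\<in>A. \<forall>x\<in>A. f x \<le> f a"
proof -
  have "Max (f ` A) \<in> f ` A" using assms by (intro Max_in) auto
  then obtain a where a: "a \<in> A" "Max (f ` A) = f a" by blast
  have "f x \<le> f a" if "x \<in> A" for x
    using Max_ge[of "f ` A" "f x"] assms(1) a that by simp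
  with a show ?thesis by blast
qed

text \<open>Without multiple arcs, the pairs of ends carry all the information. The assumption
  \<open>far\<close> is the lower bound on the outradius.\<close>

locale eccentric_digraph =
  fixes V :: "'a set" and E :: "('a \<times> 'a) set" and r :: nat
  assumes finite_V: "finite V"
    and E_sub: "E \<subseteq> V \<times> V"
    and irrefl: "(x, x) \<notin> E"
    and connected: "\<lbrakk>x \<in> V; y \<in> V\<rbrakk> \<Longrightarrow> (x, y) \<in> E\<^sup>*"
    and far: "x \<in> V \<Longrightarrow> \<exists>y\<in>V. r \<le> gdist E x y"
    and r_ge: "4 \<le> r"
begin

abbreviation d :: "'a \<Rightarrow> 'a \<Rightarrow> nat" where "d \<equiv> gdist E"

abbreviation n :: nat where "n \<equiv> card V"

definition out_missed :: "'a \<Rightarrow> 'a set" where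
  "out_missed x = {y \<in> V. y \<noteq> x \<and> (x, y) \<notin> E}"

definition in_missed :: "'a \<Rightarrow> 'a set" where
  "in_missed y = {x \<in> V. x \<noteq> y \<and> (x, y) \<notin> E}"

definition in_nbrs :: "'a \<Rightarrow> 'a set" where
  "in_nbrs y = {x. (x, y) \<in> E}"

definition missing :: "('a \<times> 'a) set" where
  "missing = {(x, y). x \<in> V \<and> y \<in> V \<and> x \<noteq> y \<and> (x, y) \<notin> E}"

lemma EV: "(x, y) \<in> E \<Longrightarrow> x \<in> V" "(x, y) \<in> E \<Longrightarrow> y \<in> V"
  using E_sub by auto

lemma finite_out_missed [simp]: "finite (out_missed x)" and finite_in_missed [simp]: "finite (in_missed x)"
  and finite_in_nbrs [simp]: "finite (in_nbrs x)"
  using finite_V EV by (auto simp: out_missed_def in_missed_def in_nbrs_def intro: finite_subset[of _ V])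

lemma finite_missing [simp]: "finite missing"
  by (rule finite_subset[of _ "V \<times> V"]) (use finite_V in \<open>auto simp: missing_def\<close>)

lemma gdist_rel: "\<lbrakk>x \<in> V; y \<in> V\<rbrakk> \<Longrightarrow> (x, y) \<in> E ^^ d x y"
  by (rule relpow_gdist[OF connected])

lemma gdist_triangle:
  assumes "x \<in> V" "y \<in> V" "z \<in> V"
  shows "d x z \<le> d x y + d y z"
proof (rule gdist_le)
  show "(x, z) \<in> E ^^ (d x y + d y z)"
    unfolding relpow_add using gdist_rel[OF assms(1,2)] gdist_rel[OF assms(2,3)]
    by (rule relcompI)
qed

lemma gdist_self [simp]: "d x x = 0"
  using gdist_le[of x x 0] by simp

lemma gdist_eq_0: "\<lbrakk>x \<in> V; y \<in> V; d x y = 0\<rbrakk> \<Longrightarrow> x = y"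
  using gdist_rel[of x y] by simp

lemma gdist_edge: "(x, y) \<in> E \<Longrightarrow> d x y \<le> 1"
  by (rule gdist_le) simp

lemma gdist_edge_triangle: "\<lbrakk>(x, y) \<in> E; z \<in> V\<rbrakk> \<Longrightarrow> d x z \<le> Suc (d y z)"
  using gdist_triangle[of x y z] gdist_edge[of x y] EV[of x y] by simp

lemma gdist_edge_triangle': "\<lbrakk>(y, z) \<in> E; x \<in> V\<rbrakk> \<Longrightarrow> d x z \<le> Suc (d x y)"
  using gdist_triangle[of x y z] gdist_edge[of y z] EV[of y z] by simp

lemma gdist_le_1: "\<lbrakk>x \<in> V; y \<in> V; d x y \<le> 1\<rbrakk> \<Longrightarrow> x = y \<or> (x, y) \<in> E"
  using gdist_rel[of x y] by (cases "d x y") auto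

text \<open>This turns every lower bound on a distance into a missing arc; all the counts below rest
  on it.\<close>

lemma mem_out_missed:
  assumes "x \<in> V" "y \<in> V"
  shows "y \<in> out_missed x \<longleftrightarrow> 2 \<le> d x y"
proof -
  have "d x y \<le> 1 \<longleftrightarrow> x = y \<or> (x, y) \<in> E"
    using gdist_le_1[OF assms] gdist_edge[of x y] by auto
  moreover have "2 \<le> d x y \<longleftrightarrow> \<not> d x y \<le> 1" by linarith
  ultimately show ?thesis using assms by (auto simp: out_missed_def)
qed

lemma mem_in_missed: "\<lbrakk>x \<in> V; y \<in> V\<rbrakk> \<Longrightarrow> x \<in> in_missed y \<longleftrightarrow> 2 \<le> d x y"
  using mem_out_missed[of x y] unfolding out_missed_def in_missed_def by auto

section \<open>Geodesics\<close>

definition geodesic :: "(nat \<Rightarrow> 'a) \<Rightarrow> 'a \<Rightarrow> 'a \<Rightarrow> bool" where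
  "geodesic p x y \<longleftrightarrow> p 0 = x \<and> p (d x y) = y \<and> (\<forall>i\<le>d x y. p i \<in> V) \<and>
     (\<forall>i j. i \<le> j \<longrightarrow> j \<le> d x y \<longrightarrow> d (p i) (p j) = j - i)"

text \<open>Subpaths of a shortest path are shortest: the path bounds the distances on its three
  stretches from above, and these bounds add up to \<open>d x y\<close>.\<close>

lemma ex_geodesic:
  assumes "x \<in> V" "y \<in> V"
  shows "\<exists>p. geodesic p x y"
proof -
  let ?m = "d x y"
  from gdist_rel[OF assms] obtain p where p: "p 0 = x" "p ?m = y"
    and edge: "\<And>i. i < ?m \<Longrightarrow> (p i, p (Suc i)) \<in> E"
    unfolding relpow_fun_conv by auto
  have pV: "p i \<in> V" if "i \<le> ?m" for i
  proof (cases i)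
    case (Suc k)
    then show ?thesis using EV(2)[OF edge[of k]] that by simp
  qed (use p assms in simp)
  have le: "d (p i) (p j) \<le> j - i" if "i \<le> j" "j \<le> ?m" for i j
    using that
  proof (induction j rule: dec_induct)
    case (step k)
    have "d (p i) (p (Suc k)) \<le> Suc (d (p i) (p k))"
      using step.hyps step.prems by (intro gdist_edge_triangle' edge pV) linarith+
    then show ?case using step by simp
  qed simp
  have "d (p i) (p j) = j - i" if ij: "i \<le> j" "j \<le> ?m" for i j
  proof -
    have V: "p i \<in> V" "p j \<in> V" using ij by (auto intro: pV)
    have "?m \<le> d x (p i) + d (p i) y" "d (p i) y \<le> d (p i) (p j) + d (p j) y"
      using V assms by (auto intro: gdist_triangle)
    moreover have "d x (p i) \<le> i" "d (p j) y \<le> ?m - j"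
      using le[of 0 i] le[of j ?m] ij p by auto
    ultimately show ?thesis using le[OF ij] ij by linarith
  qed
  with p pV show ?thesis unfolding geodesic_def by (intro exI[of _ p]) simp
qed

lemma geodesic_0: "geodesic p x y \<Longrightarrow> p 0 = x"
  and geodesic_end: "geodesic p x y \<Longrightarrow> p (d x y) = y"
  and geodesic_V: "\<lbrakk>geodesic p x y; i \<le> d x y\<rbrakk> \<Longrightarrow> p i \<in> V"
  and geodesic_dist: "\<lbrakk>geodesic p x y; i \<le> j; j \<le> d x y\<rbrakk> \<Longrightarrow> d (p i) (p j) = j - i"
  unfolding geodesic_def by blast+

lemma geodesic_dist_0: "\<lbrakk>geodesic p x y; i \<le> d x y\<rbrakk> \<Longrightarrow> d x (p i) = i"
  using geodesic_dist[of p x y 0 i] geodesic_0[of p x y] by simp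

lemma geodesic_dist_end: "\<lbrakk>geodesic p x y; i \<le> d x y\<rbrakk> \<Longrightarrow> d (p i) y = d x y - i"
  using geodesic_dist[of p x y i "d x y"] geodesic_end[of p x y] by simp

lemma geodesic_inj: "geodesic p x y \<Longrightarrow> inj_on p {..d x y}"
  by (rule inj_on_inverseI[of _ "d x"]) (simp add: geodesic_dist_0)

section \<open>Missing arcs counted by tails and by heads\<close>

lemma card_missing_out_missed: "card missing = (\<Sum>x\<in>V. card (out_missed x))"
proof -
  have "missing = Sigma V out_missed"
    by (auto simp: missing_def out_missed_def)
  then show ?thesis using finite_V by simp
qed

lemma card_missing_in_missed: "card missing = (\<Sum>y\<in>V. card (in_missed y))"
proof -
  have "missing = prod.swap ` Sigma V in_missed"
    by (auto simp: missing_def in_missed_def image_iff)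
  then show ?thesis using finite_V by (simp add: card_image)
qed

lemma card_in_missed_in_nbrs:
  assumes "y \<in> V"
  shows "card (in_missed y) + card (in_nbrs y) + 1 = n"
proof -
  have *: "V = insert y (in_missed y \<union> in_nbrs y)"
    using assms EV irrefl by (auto simp: in_missed_def in_nbrs_def)
  have "in_missed y \<inter> in_nbrs y = {}" "y \<notin> in_missed y \<union> in_nbrs y"
    using irrefl by (auto simp: in_missed_def in_nbrs_def)
  then have "card (insert y (in_missed y \<union> in_nbrs y)) = card (in_missed y) + card (in_nbrs y) + 1"
    by (simp add: card_Un_disjoint)
  then show ?thesis using * by simp
qed

text \<open>An in-neighbour of \<open>y\<close> within distance 1 of \<open>x\<close> would put
  \<open>y\<close> within distance 2. So a vertex that misses few others is within distance 2 of all
  but vertices of small in-degree.\<close>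

lemma card_in_nbrs_le_out_missed:
  assumes "x \<in> V" "y \<in> V" "3 \<le> d x y"
  shows "card (in_nbrs y) \<le> card (out_missed x)"
proof (rule card_mono)
  show "in_nbrs y \<subseteq> out_missed x"
  proof
    fix z assume z: "z \<in> in_nbrs y"
    then have zV: "z \<in> V" and e: "(z, y) \<in> E" using EV by (auto simp: in_nbrs_def)
    have "d x y \<le> Suc (d x z)" using e assms by (intro gdist_edge_triangle')
    then show "z \<in> out_missed x" using mem_out_missed[of x z] assms zV by simp
  qed
qed simp

lemma card_out_missed_ge_in_missed:
  assumes "x \<in> V" "y \<in> V" "3 \<le> d x y"
  shows "n \<le> card (out_missed x) + card (in_missed y) + 1"
  using card_in_nbrs_le_out_missed[OF assms] card_in_missed_in_nbrs[of y] assms by simp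

lemma card_out_missed_ge:
  assumes "x \<in> V"
  shows "r - 1 \<le> card (out_missed x)"
proof -
  obtain y where y: "y \<in> V" "r \<le> d x y" using far[OF assms] by auto
  obtain p where p: "geodesic p x y" using ex_geodesic[OF assms y(1)] by blast
  have "p ` {2..r} \<subseteq> out_missed x"
  proof
    fix z assume "z \<in> p ` {2..r}"
    then obtain i where i: "z = p i" "2 \<le> i" "i \<le> r" by auto
    then show "z \<in> out_missed x"
      using mem_out_missed[OF assms geodesic_V[OF p, of i]] geodesic_dist_0[OF p, of i] y(2) by simp
  qed
  moreover have "inj_on p {2..r}"
    by (rule inj_on_subset[OF geodesic_inj[OF p]]) (use y in auto)
  ultimately show ?thesis
    using card_mono[of "out_missed x" "p ` {2..r}"] by (simp add: card_image)
qed

section \<open>Vertices of small defect\<close>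

definition core :: "nat \<Rightarrow> 'a set" where
  "core D = {c \<in> V. card (out_missed c) \<le> D \<and> card (in_missed c) \<le> D}"

definition low :: "nat \<Rightarrow> 'a set" where
  "low D = {y \<in> V. card (in_nbrs y) \<le> D}"

text \<open>Vertices at distance 3 or more from a core vertex lie in \<open>low D\<close>.
  Forbidding arcs into \<open>low D\<close> discards few vertices, as \<open>low D\<close> is small
  and so are the in-degrees there.\<close>

definition good :: "nat \<Rightarrow> 'a set" where
  "good D = {c \<in> core D. \<forall>q\<in>low D. c \<notin> in_nbrs q}"

lemma core_V: "c \<in> core D \<Longrightarrow> c \<in> V"
  and good_core: "c \<in> good D \<Longrightarrow> c \<in> core D"
  by (auto simp: core_def low_def good_def)

lemma finite_core [simp]: "finite (core D)" and finite_low [simp]: "finite (low D)"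
  and finite_good [simp]: "finite (good D)"
  using finite_V by (auto simp: core_def low_def good_def)

lemma core_dist_low: "\<lbrakk>s \<in> core D; y \<in> V; 3 \<le> d s y\<rbrakk> \<Longrightarrow> y \<in> low D"
  using card_in_nbrs_le_out_missed[of s y] by (auto simp: core_def low_def)

lemma low_not_core: "\<lbrakk>y \<in> low D; 2 * D + 1 < n\<rbrakk> \<Longrightarrow> y \<notin> core D"
  using card_in_missed_in_nbrs[of y] by (auto simp: core_def low_def)

lemma far_not_core: "\<lbrakk>c \<in> core D; x \<in> V; 3 \<le> d x c; 2 * D + 1 < n\<rbrakk> \<Longrightarrow> x \<notin> core D"
  using card_out_missed_ge_in_missed[of x c] by (auto simp: core_def)

text \<open>Missing arcs out of \<open>c\<close> come from the geodesics \<open>p\<close> to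
  \<open>a\<close> and \<open>q\<close> to \<open>b\<close>; missing arcs into \<open>c\<close> come
  from the geodesic \<open>s\<close> leading from \<open>u\<close> back to \<open>c\<close>. For the
  latter only tails outside the core are counted, so that summing over all good \<open>c\<close>
  counts no arc twice.\<close>

lemma good_vertex:
  assumes c: "c \<in> good D" and D: "2 * D + 1 < n"
  shows "2 * r - 3 \<le> card (out_missed c) + card (in_missed c - core D)"
    and "in_missed c - core D \<noteq> {} \<Longrightarrow> 2 * r - 2 \<le> card (out_missed c) + card (in_missed c - core D)"
proof -
  let ?I = "in_missed c - core D"
  have cc: "c \<in> core D" and cV: "c \<in> V"
    using c good_core core_V by auto
  have c_low: False if "(c, y) \<in> E" "y \<in> low D" for y
    using c that by (auto simp: good_def in_nbrs_def)
  obtain a where a: "a \<in> V" and a_max: "\<And>y. y \<in> V \<Longrightarrow> d c y \<le> d c a"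
    using ex_maximum[OF finite_V, of "d c"] cV by auto
  define m where "m = d c a"
  have m: "r \<le> m" using far[OF cV] a_max unfolding m_def by (meson le_trans)
  obtain p where p: "geodesic p c a" using ex_geodesic[OF cV a] by blast
  have pV: "p i \<in> V" if "i \<le> m" for i using geodesic_V[OF p] that by (simp add: m_def)
  have p_dist: "d (p i) (p j) = j - i" if "i \<le> j" "j \<le> m" for i j
    using geodesic_dist[OF p] that by (simp add: m_def)
  have dp: "d c (p i) = i" if "i \<le> m" for i
    using geodesic_dist_0[OF p] that by (simp add: m_def)
  \<comment> \<open>Since \<open>m - e = r - 1\<close>, a common vertex of \<open>p\<close> and
    \<open>q\<close> beyond \<open>u\<close> would give
    \<open>d u b \<le> g - e \<le> r - 1\<close>.\<close>
  define e where "e = m - r + 1"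
  have e: "1 \<le> e" "e \<le> m" using m r_ge by (auto simp: e_def)
  define u where "u = p e"
  have uV: "u \<in> V" using pV e by (simp add: u_def)
  obtain b where b: "b \<in> V" "r \<le> d u b" using far[OF uV] by blast
  define g where "g = d c b"
  have g_le: "g \<le> m" using a_max[OF b(1)] by (simp add: g_def m_def)
  obtain q where q: "geodesic q c b" using ex_geodesic[OF cV b(1)] by blast
  have qV: "q i \<in> V" if "i \<le> g" for i using geodesic_V[OF q] that by (simp add: g_def)
  have dq: "d c (q i) = i" if "i \<le> g" for i
    using geodesic_dist_0[OF q] that by (simp add: g_def)
  have dqb: "d (q i) b = g - i" if "i \<le> g" for i
    using geodesic_dist_end[OF q] that by (simp add: g_def)
  have pq: "p i \<noteq> q j" if "i \<le> m" "e \<le> j" "j \<le> g" for i j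
  proof
    assume eq: "p i = q j"
    then have ij: "i = j" using dp[OF that(1)] dq[OF that(3)] by simp
    have "d u b \<le> d u (p i) + d (p i) b"
      using gdist_triangle[OF uV pV[OF that(1)] b(1)] .
    also have "d u (p i) = i - e" unfolding u_def using p_dist[of e i] that ij by simp
    also have "d (p i) b = g - i" using eq ij dqb that by simp
    finally show False using b(2) g_le that ij m r_ge unfolding e_def by linarith
  qed
  define PO where "PO = p ` {2..m}"
  \<comment> \<open>Vertices of \<open>q\<close> before index \<open>e\<close> may lie on
    \<open>p\<close>, and those before index 2 are not missed by \<open>c\<close>.\<close>
  define QO where "QO = q ` {max 2 e..g}"
  have PQ: "PO \<union> QO \<subseteq> out_missed c"
  proof
    fix z assume "z \<in> PO \<union> QO"
    then have "z \<in> V \<and> 2 \<le> d c z"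
      using pV dp qV dq by (auto simp: PO_def QO_def)
    then show "z \<in> out_missed c" using mem_out_missed cV by simp
  qed
  have injp: "inj_on p {..m}" using geodesic_inj[OF p] by (simp add: m_def)
  have injq: "inj_on q {..g}" using geodesic_inj[OF q] by (simp add: g_def)
  have "card PO = m - 1" unfolding PO_def
    by (subst card_image[OF inj_on_subset[OF injp]]) auto
  moreover have "card QO = g + 1 - max 2 e" unfolding QO_def
    by (subst card_image[OF inj_on_subset[OF injq]]) auto
  moreover have "PO \<inter> QO = {}" using pq by (force simp: PO_def QO_def)
  ultimately have cPQ: "card (PO \<union> QO) = (m - 1) + (g + 1 - max 2 e)"
    by (subst card_Un_disjoint) (auto simp: PO_def QO_def)
  have O_ge: "(m - 1) + (g + 1 - max 2 e) \<le> card (out_missed c)"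
    using card_mono[OF finite_out_missed PQ] cPQ by simp
  define K where "K = d u c"
  obtain s where s: "geodesic s u c" using ex_geodesic[OF uV cV] by blast
  have sV: "s i \<in> V" if "i \<le> K" for i using geodesic_V[OF s] that by (simp add: K_def)
  have ds: "d u (s i) = i" if "i \<le> K" for i
    using geodesic_dist_0[OF s] that by (simp add: K_def)
  have dsc: "d (s i) c = K - i" if "i \<le> K" for i
    using geodesic_dist_end[OF s] that by (simp add: K_def)
  have s0: "s 0 = u" using geodesic_0[OF s] .
  have injs: "inj_on s {..K}" using geodesic_inj[OF s] by (simp add: K_def)
  have K1: "1 \<le> K"
  proof -
    have "d c u = e" using dp e by (simp add: u_def)
    then have "u \<noteq> c" using e by auto
    then show ?thesis using gdist_eq_0[OF uV cV] unfolding K_def by linarith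
  qed
  have rKg: "r \<le> K + g"
    using gdist_triangle[OF uV cV b(1)] b(2) by (simp add: K_def g_def)
  have finI: "finite ?I" by simp
  have s_I: "s i \<in> ?I" if "i + 3 \<le> K" for i
    using far_not_core[OF cc sV _ D, of i] mem_in_missed[OF sV cV, of i] dsc[of i] that by simp
  \<comment> \<open>\<open>h\<close> counts the vertices of \<open>s\<close> known to lie in
    \<open>?I\<close>. Only \<open>s (K - 2)\<close>, at distance 2 from \<open>c\<close>, can be in
    the core; the loss of one is then offset by \<open>K + g\<close> exceeding \<open>r\<close>, or,
    if \<open>b = c\<close>, by the truncation of \<open>g - 1\<close>.\<close>
  obtain h where hI: "s ` {..<h} \<subseteq> ?I" and hK: "h < K"
    and h: "(h = K - 1 \<or> h + 2 = K \<and> (g \<noteq> 0 \<longrightarrow> r + 1 \<le> K + g))"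
  proof (cases "2 \<le> K \<and> s (K - 2) \<in> core D")
    case True
    define z where "z = s (K - 2)"
    have z: "z \<in> V" "z \<in> core D" "d u z = K - 2"
      using True sV ds by (auto simp: z_def)
    \<comment> \<open>Otherwise the successor \<open>q 1\<close> of \<open>c\<close> on the way to
      \<open>b\<close> is at distance at least 3 from the core vertex \<open>z\<close>, hence in
      \<open>low D\<close>, although \<open>c\<close> is good.\<close>
    have "r + 1 \<le> K + g" if "g \<noteq> 0"
    proof (rule ccontr)
      assume "\<not> r + 1 \<le> K + g"
      moreover have "r \<le> (K - 2) + d z b"
        using gdist_triangle[OF uV z(1) b(1)] b(2) z(3) by simp
      ultimately have zb: "g + 2 \<le> d z b" using True by linarith
      have q1: "q 1 \<in> V" "d c (q 1) = 1" using qV dq that by auto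
      have "c \<noteq> q 1" using q1(2) by auto
      then have "(c, q 1) \<in> E" using gdist_le_1[OF cV q1(1)] q1(2) by auto
      moreover have "d z b \<le> d z (q 1) + (g - 1)"
        using gdist_triangle[OF z(1) q1(1) b(1)] dqb[of 1] that by simp
      then have "q 1 \<in> low D"
        using zb that by (intro core_dist_low[OF z(2) q1(1)]) linarith
      ultimately show False by (rule c_low)
    qed
    moreover have "s ` {..<K - 2} \<subseteq> ?I" using s_I by auto
    moreover have "K - 2 < K" "K - 2 + 2 = K" using True by auto
    ultimately show thesis using that[of "K - 2"] by blast
  next
    case False
    have "s i \<in> ?I" if "i < K - 1" for i
    proof (cases "i + 3 \<le> K")
      case True then show ?thesis by (rule s_I)
    next
      case F: False
      then have "i = K - 2" "2 \<le> K" using that by auto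
      then show ?thesis
        using mem_in_missed[OF sV cV, of i] dsc[of i] False by auto
    qed
    then have "s ` {..<K - 1} \<subseteq> ?I" by auto
    moreover have "K - 1 < K" using K1 by simp
    ultimately show thesis using that[of "K - 1"] by blast
  qed
  have chI: "card (s ` {..<h}) = h"
    using hK by (subst card_image[OF inj_on_subset[OF injs]]) auto
  have I_ge: "h \<le> card ?I" using card_mono[OF finI hI] chI by simp
  show first: "2 * r - 3 \<le> card (out_missed c) + card ?I"
    using O_ge I_ge h rKg m e K1 r_ge unfolding e_def by (cases "g = 0"; linarith)
  \<comment> \<open>Equality in the first bound would force \<open>m = r\<close> and make the
    vertices found so far exhaust \<open>out_missed c\<close> and \<open>?I\<close>. The vertices
    \<open>p 1\<close>, \<open>p 3\<close>, ..., \<open>p (r - 1)\<close>, possibly with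
    \<open>s 1\<close>, then overfill \<open>?I\<close>.\<close>
  show "2 * r - 2 \<le> card (out_missed c) + card ?I" if Ine: "?I \<noteq> {}"
  proof (rule ccontr)
    assume "\<not> ?thesis"
    then have sum: "card (out_missed c) + card ?I = 2 * r - 3" using first by linarith
    have I1: "1 \<le> card ?I" using Ine finI by (simp add: Suc_le_eq card_gt_0_iff)
    have mr: "m = r"
    proof (rule ccontr)
      assume "m \<noteq> r"
      then have "max 2 e = e" "r + 1 \<le> m" using m by (auto simp: e_def)
      then show False
        using O_ge I_ge h rKg K1 r_ge sum unfolding e_def by (cases "g = 0") linarith+
    qed
    then have e1: "e = 1" by (simp add: e_def)
    have O_ge': "(r - 1) + (g - 1) \<le> card (out_missed c)" using O_ge mr e1 by simp
    have hg: "h + 1 + g \<le> r"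
      using O_ge' I_ge h rKg K1 r_ge sum I1 by (cases "g = 0") linarith+
    have cO: "card (out_missed c) \<le> (r - 1) + (g - 1)"
      using O_ge' I_ge h rKg K1 r_ge sum I1 by (cases "g = 0") linarith+
    have cI: "card ?I \<le> h"
      using O_ge' I_ge h rKg K1 r_ge sum I1 by (cases "g = 0") linarith+
    have hr: "h \<le> r - 2" "g \<le> r - 2" using O_ge' I_ge sum hg cI I1 r_ge by linarith+
    have tight: "m = r" "card (out_missed c) = card (PO \<union> QO)" "card ?I = h" "h \<le> r - 2" "g \<le> r - 2"
      using mr cO O_ge' cI I_ge hr cPQ e1 by auto
    have omc: "out_missed c = PO \<union> QO" using card_subset_eq[OF finite_out_missed PQ] tight by simp
    have Is: "?I = s ` {..<h}" using card_subset_eq[OF finI hI] chI tight by simp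
    \<comment> \<open>An arc from \<open>p i\<close> to \<open>c\<close> would give a vertex
      \<open>y\<close> at distance at least \<open>r\<close> from \<open>p i\<close> and at least
      \<open>r - 1\<close> from \<open>c\<close>. It would be missed by \<open>c\<close>, so lie on
      \<open>p\<close> or \<open>q\<close>; but \<open>p\<close> ends too close to
      \<open>p i\<close>, and \<open>q\<close> is too short.\<close>
    have p_in_missed: "p i \<in> in_missed c" if i: "1 \<le> i" "i \<le> r - 1" for i
    proof (rule ccontr)
      assume no: "p i \<notin> in_missed c"
      have in_missed: "i \<le> m" using i tight by linarith
      have "p i \<noteq> c" using dp[OF in_missed] i by auto
      then have edge: "(p i, c) \<in> E" using no pV[OF in_missed] by (simp add: in_missed_def)
      obtain y where y: "y \<in> V" "r \<le> d (p i) y" using far[OF pV[OF in_missed]] by blast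
      have cy: "r - 1 \<le> d c y" using gdist_edge_triangle[OF edge y(1)] y(2) by linarith
      then have "y \<in> out_missed c" using mem_out_missed[OF cV y(1)] r_ge by simp
      then consider j where "y = p j" "2 \<le> j" "j \<le> m" | j where "y = q j" "j \<le> g"
        unfolding omc by (auto simp: PO_def QO_def)
      then show False
      proof cases
        case 1
        then have "r - 1 \<le> j" using cy dp by simp
        then have "d (p i) y = j - i" using p_dist[of i j] i 1 by simp
        then show False using y(2) i 1 tight r_ge by linarith
      next
        case 2
        then have "r - 1 \<le> g" using cy dq by simp
        then show False using tight r_ge by linarith
      qed
    qed
    have p_I: "p i \<in> ?I" if "3 \<le> i" "i \<le> r - 1" for i
    proof -
      have in_missed: "i \<le> m" using that tight by linarith
      have "p i \<in> low D" by (rule core_dist_low[OF cc pV[OF in_missed]]) (use dp[OF in_missed] that in simp)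
      then show ?thesis using low_not_core[OF _ D] p_in_missed that by simp
    qed
    have h1: "1 \<le> h" using tight I1 by simp
    have p1: "p 1 = s 0" using s0 e1 by (simp add: u_def)
    have p1I: "p 1 \<in> ?I" unfolding p1 Is using h1 by simp
    \<comment> \<open>\<open>p 2\<close> is left out: at distance only 2 from \<open>c\<close>, it
      is not known to be in \<open>low D\<close>.\<close>
    define W where "W = p ` insert 1 {3..r - 1}"
    have W: "W \<subseteq> ?I" unfolding W_def using p_I p1I by auto
    have cW: "card W = r - 2" unfolding W_def
      using tight r_ge by (subst card_image[OF inj_on_subset[OF injp]]) auto
    show False
    proof (cases "h = 1")
      case True
      then show False using card_mono[OF finI W] cW tight r_ge by simp
    next
      case False
      then have h2: "2 \<le> h" using h1 by simp
      then have s1: "s 1 \<in> ?I" unfolding Is by auto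
      have "s 1 \<notin> W"
      proof
        assume "s 1 \<in> W"
        then consider "s 1 = s 0" | i where "s 1 = p i" "3 \<le> i" "i \<le> r - 1"
          unfolding W_def p1[symmetric] by auto
        then show False
        proof cases
          case 1
          then show False using ds[of 0] ds[of 1] h2 hK by simp
        next
          case 2
          have "d c (s 1) \<le> d c u + d u (s 1)"
            using gdist_triangle[OF cV uV sV] h2 hK by simp
          also have "\<dots> = 2" using ds[of 1] dp[of e] e e1 h2 hK by (simp add: u_def)
          finally show False using 2 dp[of i] tight by simp
        qed
      qed
      then have "card (insert (s 1) W) = r - 1"
        using cW finite_subset[OF W finI] r_ge by simp
      then show False using card_mono[OF finI, of "insert (s 1) W"] W s1 tight r_ge by simp
    qed
  qed
qed

section \<open>A uniform bound on out-defects from global counting\<close>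

lemma sum_good_le_missing:
  "(\<Sum>c\<in>good D. card (out_missed c) + card (in_missed c - core D)) \<le> card missing"
proof -
  let ?A = "Sigma (good D) out_missed" and ?B = "prod.swap ` Sigma (good D) (\<lambda>c. in_missed c - core D)"
  \<comment> \<open>Tails in \<open>?A\<close> belong to the core, tails in \<open>?B\<close> do
    not.\<close>
  have "?A \<inter> ?B = {}"
    using good_core by auto
  then have "card (?A \<union> ?B) = card ?A + card ?B"
    by (intro card_Un_disjoint) auto
  moreover have "card ?A = (\<Sum>c\<in>good D. card (out_missed c))" by simp
  moreover have "card ?B = (\<Sum>c\<in>good D. card (in_missed c - core D))" by (simp add: card_image)
  moreover have "?A \<union> ?B \<subseteq> missing"
    using core_V[OF good_core] by (auto simp: missing_def out_missed_def in_missed_def)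
  then have "card (?A \<union> ?B) \<le> card missing" by (intro card_mono) simp_all
  ultimately show ?thesis by (simp add: sum.distrib)
qed

lemma card_not_core: "card (V - core D) * (D + 1) \<le> 2 * card missing"
proof -
  have "card (V - core D) * (D + 1) = (\<Sum>x\<in>V - core D. D + 1)" by simp
  also have "\<dots> \<le> (\<Sum>x\<in>V - core D. card (out_missed x) + card (in_missed x))"
    by (rule sum_mono) (auto simp: core_def)
  also have "\<dots> \<le> (\<Sum>x\<in>V. card (out_missed x) + card (in_missed x))"
    using finite_V by (intro sum_mono2) auto
  also have "\<dots> = 2 * card missing"
    using card_missing_out_missed card_missing_in_missed by (simp add: sum.distrib)
  finally show ?thesis .
qed

lemma card_low: "card (low D) * (n - 1 - D) \<le> card missing"
proof -
  have "card (low D) * (n - 1 - D) = (\<Sum>y\<in>low D. n - 1 - D)" by simp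
  also have "\<dots> \<le> (\<Sum>y\<in>low D. card (in_missed y))"
  proof (rule sum_mono)
    fix y assume "y \<in> low D"
    then show "n - 1 - D \<le> card (in_missed y)"
      using card_in_missed_in_nbrs[of y] by (auto simp: low_def)
  qed
  also have "\<dots> \<le> (\<Sum>y\<in>V. card (in_missed y))"
    using finite_V by (intro sum_mono2) (auto simp: low_def)
  also have "\<dots> = card missing" by (simp add: card_missing_in_missed)
  finally show ?thesis .
qed

lemma card_not_good: "card (V - good D) \<le> card (V - core D) + card (low D) * D"
proof -
  have sub: "V - good D \<subseteq> (V - core D) \<union> (\<Union>q\<in>low D. in_nbrs q)"
    by (auto simp: good_def)
  have "card (V - good D) \<le> card ((V - core D) \<union> (\<Union>q\<in>low D. in_nbrs q))"
    using finite_V by (intro card_mono[OF _ sub]) auto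
  also have "\<dots> \<le> card (V - core D) + card (\<Union>q\<in>low D. in_nbrs q)"
    by (rule card_Un_le)
  also have "card (\<Union>q\<in>low D. in_nbrs q) \<le> (\<Sum>q\<in>low D. card (in_nbrs q))"
    by (rule card_UN_le) simp
  also have "\<dots> \<le> card (low D) * D"
    using sum_bounded_above[of "low D" "\<lambda>q. card (in_nbrs q)" D] by (simp add: low_def)
  finally show ?thesis by simp
qed

text \<open>Each good vertex missed from outside the core costs one arc beyond
  \<open>2 * r - 3\<close>. The budget \<open>M\<close> leaves room for few such vertices, and a
  vertex outside the core can miss only these and the vertices that are not good.\<close>

lemma card_out_missed_le:
  assumes M: "card missing \<le> (2 * r - 3) * n" and D: "2 * D + 1 < n" and x: "x \<in> V"
  shows "card (out_missed x) \<le> D + (2 * r - 2) * card (V - good D)"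
proof (cases "x \<in> core D")
  case True
  then show ?thesis by (simp add: core_def)
next
  case False
  define W where "W = {c \<in> good D. in_missed c - core D \<noteq> {}}"
  have gV: "good D \<subseteq> V" using good_core core_V by blast
  have "(2 * r - 3) * card (good D) + card W = (\<Sum>c\<in>good D. (2 * r - 3) + (if c \<in> W then 1 else 0))"
    unfolding sum.distrib by (simp add: sum.If_cases W_def Int_def)
  also have "\<dots> \<le> (\<Sum>c\<in>good D. card (out_missed c) + card (in_missed c - core D))"
  proof (rule sum_mono)
    fix c assume c: "c \<in> good D"
    show "(2 * r - 3) + (if c \<in> W then 1 else 0) \<le> card (out_missed c) + card (in_missed c - core D)"
      using good_vertex[OF c D] r_ge by (auto simp: W_def)
  qed
  also have "\<dots> \<le> (2 * r - 3) * n" using sum_good_le_missing M by (rule le_trans)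
  also have "n = card (good D) + card (V - good D)"
    using card_Un_disjoint[of "good D" "V - good D"] finite_V gV by (simp add: Un_absorb1)
  finally have W: "card W \<le> (2 * r - 3) * card (V - good D)" by (simp add: algebra_simps)
  have "out_missed x \<subseteq> (V - good D) \<union> W"
    using False x by (auto simp: W_def out_missed_def in_missed_def)
  then have "card (out_missed x) \<le> card ((V - good D) \<union> W)"
    using finite_V by (intro card_mono) (auto simp: W_def)
  also have "\<dots> \<le> card (V - good D) + card W" by (rule card_Un_le)
  also have "\<dots> \<le> card (V - good D) + (2 * r - 3) * card (V - good D)" using W by simp
  also have "\<dots> = (2 * r - 2) * card (V - good D)"
    using r_ge by (simp add: algebra_simps flip: add_mult_distrib)
  finally show ?thesis by simp
qed


text \<open>The source of the threshold on \<open>n\<close>. With \<open>D\<close> about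
  \<open>n / (64 * r ^ 4)\<close>, the number of vertices outside the core is bounded in terms of
  \<open>r\<close> alone and \<open>low D\<close> has at most \<open>2 * r\<close> elements, so the
  vertices that are not good form a small fraction of \<open>V\<close>.\<close>

lemma out_missed_uniformly_small:
  assumes M: "card missing \<le> (2 * r - 3) * n" and n: "4096 * r ^ 8 + 16 * r ^ 2 < n"
  obtains H where "\<And>x. x \<in> V \<Longrightarrow> card (out_missed x) \<le> H" "4 * r ^ 2 * (H + 1) < n"
proof -
  define L where "L = 64 * r ^ 4"
  define D where "D = n div L"
  have r4: "4 \<le> r" by (rule r_ge)
  have L: "0 < L" using r4 by (simp add: L_def)
  have DL: "D * L \<le> n" by (simp add: D_def)
  have nL: "n < L * (D + 1)"
    unfolding D_def using L by (simp add: dividend_less_times_div)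
  have r_le: "r \<le> r ^ 4" by (rule self_le_power) (use r4 in auto)
  have D4: "64 * r * D \<le> n"
  proof -
    have "64 * r * D \<le> L * D" unfolding L_def using r_le by (intro mult_right_mono) auto
    moreover have "L * D \<le> n" using DL by (simp only: mult.commute)
    ultimately show ?thesis by (rule le_trans)
  qed
  have n_r: "16 * r < n"
  proof -
    have "r \<le> r ^ 2" by (rule self_le_power) (use r4 in auto)
    then show ?thesis using n by linarith
  qed
  have "4 * D \<le> r * D" using r4 by (intro mult_right_mono) auto
  then have D2: "2 * D + 1 < n" using D4 n_r r4 by linarith
  have core: "card (V - core D) \<le> 4 * r * L"
  proof -
    have "card (V - core D) * (D + 1) \<le> 2 * ((2 * r - 3) * n)"
      using card_not_core[of D] M by linarith
    also have "\<dots> \<le> 4 * r * n"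
    proof -
      have "(2 * r - 3) * n \<le> (2 * r) * n" by (intro mult_right_mono) auto
      then show ?thesis by (simp add: mult.assoc)
    qed
    also have "\<dots> \<le> (4 * r * L) * (D + 1)"
      using nL by (simp only: mult.assoc) (intro mult_left_mono; simp)
    finally show ?thesis by (simp only: mult_le_cancel2)
  qed
  have low: "card (low D) \<le> 2 * r"
  proof (rule ccontr)
    assume "\<not> ?thesis"
    then have "(2 * r) * (n - 1 - D) \<le> card (low D) * (n - 1 - D)"
      by (intro mult_right_mono) auto
    then have "(2 * r) * (n - 1 - D) \<le> (2 * r - 3) * n"
      using card_low[of D] M by linarith
    moreover have "(2 * r - 3) * n + 3 * n = 2 * r * n"
      using r4 by (simp flip: add_mult_distrib)
    moreover have "(2 * r) * (n - 1 - D) + 2 * r * (1 + D) = 2 * r * n"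
    proof -
      have "(n - 1 - D) + (1 + D) = n" using D2 by simp
      then show ?thesis unfolding distrib_left[symmetric] by (rule arg_cong)
    qed
    ultimately have "3 * n \<le> 2 * r * (1 + D)" by linarith
    then show False using D4 n_r by (simp add: algebra_simps)
  qed
  define H where "H = D + (2 * r - 2) * (4 * r * L + 2 * r * D)"
  have "card (out_missed x) \<le> H" if "x \<in> V" for x
  proof -
    have "card (low D) * D \<le> 2 * r * D" using low by (intro mult_right_mono) auto
    then have "card (V - good D) \<le> 4 * r * L + 2 * r * D"
      using card_not_good[of D] core by linarith
    then have "(2 * r - 2) * card (V - good D) \<le> (2 * r - 2) * (4 * r * L + 2 * r * D)"
      by (intro mult_left_mono) auto
    then show ?thesis using card_out_missed_le[OF M D2 that] unfolding H_def by linarith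
  qed
  moreover have "4 * r ^ 2 * (H + 1) < n"
  proof -
    have "D + (2 * r - 2) * (4 * r * L + 2 * r * D) \<le> 2 * r * (4 * r * L + 2 * r * D)"
    proof -
      have "D \<le> 2 * (4 * r * L + 2 * r * D)" using r4 by (cases r) auto
      moreover have "(2 * r - 2) * (4 * r * L + 2 * r * D) + 2 * (4 * r * L + 2 * r * D)
          = 2 * r * (4 * r * L + 2 * r * D)"
      proof -
        have "(2 * r - 2) + 2 = 2 * r" using r4 by simp
        then show ?thesis unfolding add_mult_distrib[symmetric] by (rule arg_cong)
      qed
      ultimately show ?thesis by linarith
    qed
    then have H: "H \<le> 2 * r * (4 * r * L + 2 * r * D)" by (simp add: H_def)
    then have "4 * r ^ 2 * (H + 1) \<le> 4 * r ^ 2 * (2 * r * (4 * r * L + 2 * r * D) + 1)"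
      by (intro mult_left_mono) auto
    also have "\<dots> = 2048 * r ^ 8 + 16 * r ^ 4 * D + 4 * r ^ 2"
    proof -
      have e: "r ^ 8 = r * r * r * r * r * r * r * r" "r ^ 4 = r * r * r * r" "r ^ 2 = r * r"
        by (simp_all add: numeral_eq_Suc mult.assoc)
      show ?thesis unfolding L_def e by (simp add: algebra_simps)
    qed
    finally have "4 * r ^ 2 * (H + 1) \<le> 2048 * r ^ 8 + 16 * r ^ 4 * D + 4 * r ^ 2" .
    \<comment> \<open>So the term with \<open>D\<close> is at most a quarter of \<open>n\<close>,
      while the threshold keeps the other two together below half of \<open>n\<close>.\<close>
    moreover have "64 * r ^ 4 * D \<le> n" using DL unfolding L_def by (simp only: mult.commute)
    ultimately show ?thesis using n n_r by linarith
  qed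
  ultimately show thesis by (rule that)
qed

end

section \<open>Layers over the vertices of large indegree\<close>

text \<open>\<open>T\<close> will be the set of vertices whose in-degree is at most the uniform
  bound \<open>H\<close> on the out-defects; then \<open>dist_le_2\<close> follows from
  \<open>card_in_nbrs_le_out_missed\<close>.\<close>

locale layered_digraph = eccentric_digraph +
  fixes T :: "'a set"
  assumes T_sub: "T \<subseteq> V" and card_T: "card T \<le> 2 * r - 3" and T_proper: "V - T \<noteq> {}"
    and dist_le_2: "\<lbrakk>x \<in> V; y \<in> V - T\<rbrakk> \<Longrightarrow> d x y \<le> 2"
begin

definition layer :: "'a \<Rightarrow> nat" where
  "layer y = (LEAST k. \<exists>x\<in>V - T. d x y = k)"

lemma finite_T [simp]: "finite T"
  using T_sub finite_V by (rule finite_subset)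

lemma layer_attained: "\<exists>x\<in>V - T. d x y = layer y"
  unfolding layer_def by (rule LeastI_ex) (use T_proper in blast)

lemma layer_le: "x \<in> V - T \<Longrightarrow> layer y \<le> d x y"
  unfolding layer_def by (rule Least_le) blast

lemma layer_triangle:
  assumes "x \<in> V" "y \<in> V"
  shows "layer y \<le> layer x + d x y"
proof -
  obtain w where w: "w \<in> V - T" "d w x = layer x" using layer_attained by blast
  then show ?thesis using layer_le[OF w(1), of y] gdist_triangle[of w x y] assms by auto
qed

lemma layer_edge: "(x, y) \<in> E \<Longrightarrow> layer y \<le> layer x + 1"
  using layer_triangle[of x y] gdist_edge[of x y] EV[of x y] by simp

lemma dist_le_layer:
  assumes "x \<in> V" "y \<in> V"
  shows "d x y \<le> layer y + 2"
proof -
  obtain w where w: "w \<in> V - T" "d w y = layer y" using layer_attained by blast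
  then show ?thesis using dist_le_2[OF assms(1) w(1)] gdist_triangle[of x w y] assms by auto
qed

lemma layer_eq_0: "y \<in> V \<Longrightarrow> layer y = 0 \<longleftrightarrow> y \<notin> T"
  by (metis Diff_iff gdist_eq_0 gdist_self layer_attained layer_le le_zero_eq)

text \<open>Going through the vertex outside \<open>T\<close> nearest to \<open>y\<close> takes at
  most \<open>layer y + 2\<close> steps, so vertices at distance \<open>r\<close> or more lie in
  deep layers.\<close>

lemma far_layer:
  assumes "x \<in> V"
  shows "\<exists>y\<in>V. r \<le> d x y \<and> r - 2 \<le> layer y"
  using far[OF assms] dist_le_layer[OF assms] by fastforce

text \<open>A geodesic leaving \<open>V - T\<close>, indexed by layers; hence two chains can meet
  only at equal indices.\<close>

definition chain :: "(nat \<Rightarrow> 'a) \<Rightarrow> nat \<Rightarrow> bool" where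
  "chain t k \<longleftrightarrow> (\<forall>i\<le>k. t i \<in> V \<and> layer (t i) = i) \<and>
     (\<forall>i j. i \<le> j \<longrightarrow> j \<le> k \<longrightarrow> d (t i) (t j) = j - i)"

lemma ex_chain:
  assumes y: "y \<in> V"
  shows "\<exists>t. chain t (layer y) \<and> t (layer y) = y"
proof -
  obtain w where w: "w \<in> V - T" "d w y = layer y" using layer_attained by blast
  obtain t where t: "geodesic t w y" using ex_geodesic[of w y] w y by blast
  have "layer (t i) = i" if i: "i \<le> layer y" for i
  proof -
    have tV: "t i \<in> V" using geodesic_V[OF t] i w by simp
    have "layer (t i) \<le> i" using layer_le[OF w(1), of "t i"] geodesic_dist_0[OF t] i w by simp
    moreover have "layer y \<le> layer (t i) + (layer y - i)"
      using layer_triangle[OF tV y] geodesic_dist_end[OF t] i w by simp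
    ultimately show ?thesis using i by simp
  qed
  then show ?thesis
    using geodesic_V[OF t] geodesic_dist[OF t] geodesic_end[OF t] w
    unfolding chain_def by (intro exI[of _ t]) simp
qed

lemma chain_V: "\<lbrakk>chain t k; i \<le> k\<rbrakk> \<Longrightarrow> t i \<in> V"
  and chain_layer: "\<lbrakk>chain t k; i \<le> k\<rbrakk> \<Longrightarrow> layer (t i) = i"
  and chain_dist: "\<lbrakk>chain t k; i \<le> j; j \<le> k\<rbrakk> \<Longrightarrow> d (t i) (t j) = j - i"
  unfolding chain_def by blast+

lemma chain_inj: "chain t k \<Longrightarrow> inj_on t {..k}"
  by (rule inj_on_inverseI[of _ layer]) (simp add: chain_layer)

lemma chain_T: "\<lbrakk>chain t k; i \<le> k\<rbrakk> \<Longrightarrow> t i \<in> T \<longleftrightarrow> 1 \<le> i"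
  using layer_eq_0[OF chain_V[of t k i]] chain_layer[of t k i] by auto

lemma card_chains:
  assumes t: "chain t k" and s: "chain s l" and I: "I \<subseteq> {..k}" and J: "J \<subseteq> {..l}"
    and dis: "\<And>j. \<lbrakk>j \<in> I; j \<in> J\<rbrakk> \<Longrightarrow> t j \<noteq> s j"
  shows "card (t ` I \<union> s ` J) = card I + card J"
proof -
  have "t i \<noteq> s j" if "i \<in> I" "j \<in> J" for i j
  proof -
    have "layer (t i) = i" "layer (s j) = j" using that I J chain_layer[OF t] chain_layer[OF s] by auto
    then show ?thesis using that dis[of i] by auto
  qed
  then have "t ` I \<inter> s ` J = {}" by auto
  moreover have "finite I" "finite J" using I J by (auto intro: finite_subset)
  ultimately have "card (t ` I \<union> s ` J) = card (t ` I) + card (s ` J)"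
    by (intro card_Un_disjoint) auto
  also have "card (t ` I) = card I" by (rule card_image[OF inj_on_subset[OF chain_inj[OF t] I]])
  also have "card (s ` J) = card J" by (rule card_image[OF inj_on_subset[OF chain_inj[OF s] J]])
  finally show ?thesis .
qed

lemma card_out_missed_geI:
  assumes "x \<in> V" and "\<And>y. y \<in> S \<Longrightarrow> y \<in> V \<and> 2 \<le> d x y"
  shows "card S \<le> card (out_missed x)"
  by (rule card_mono) (use assms mem_out_missed in auto)

text \<open>At a common vertex one could switch from \<open>t\<close> to \<open>s\<close> and reach
  \<open>s l\<close> from \<open>t e\<close> in \<open>l - e\<close> steps.\<close>

lemma chains_disjoint:
  assumes t: "chain t k" and s: "chain s l" and e: "e \<le> j" "j \<le> k" "j \<le> l"
    and far: "l - e < d (t e) (s l)"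
  shows "t j \<noteq> s j"
proof
  assume eq: "t j = s j"
  have V: "t e \<in> V" "t j \<in> V" "s l \<in> V" using chain_V[OF t] chain_V[OF s] e by auto
  have "d (t e) (s l) \<le> d (t e) (t j) + d (t j) (s l)" using V by (intro gdist_triangle)
  also have "\<dots> = (j - e) + (l - j)" unfolding eq
    using chain_dist[OF t, of e j] chain_dist[OF s, of j l] e by (simp add: eq)
  finally show False using far e by simp
qed

text \<open>The construction of \<open>good_vertex\<close> again: a layer of index \<open>r\<close>
  or more would yield two chains, disjoint beyond \<open>t e\<close>, with at least
  \<open>2 * r - 2\<close> vertices of \<open>T\<close>.\<close>

lemma layer_less: "y \<in> V \<Longrightarrow> layer y < r"
proof -
  assume yV: "y \<in> V"
  obtain a where a: "a \<in> V" and a_max: "\<And>z. z \<in> V \<Longrightarrow> layer z \<le> layer a"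
    using ex_maximum[OF finite_V, of layer] yV by auto
  have "layer a < r"
  proof (rule ccontr)
    assume "\<not> layer a < r"
    define k where "k = layer a"
    define e where "e = k - r + 1"
    have k: "r \<le> k" "1 \<le> e" "e \<le> k" using \<open>\<not> layer a < r\<close> r_ge by (auto simp: k_def e_def)
    obtain t where t: "chain t k" using ex_chain[OF a] by (auto simp: k_def)
    have u: "t e \<in> V" using chain_V[OF t] k by simp
    obtain b where b: "b \<in> V" "r \<le> d (t e) b" "r - 2 \<le> layer b" using far_layer[OF u] by blast
    define l where "l = layer b"
    obtain s where s: "chain s l" "s l = b" using ex_chain[OF b(1)] by (auto simp: l_def)
    have lk: "l \<le> k" using a_max[OF b(1)] by (simp add: l_def k_def)
    have "l - e < r" using lk k r_ge unfolding e_def by linarith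
    then have dis: "t j \<noteq> s j" if "e \<le> j" "j \<le> k" "j \<le> l" for j
      using chains_disjoint[OF t s(1) that] b(2) s(2) by simp
    have c: "card (t ` {1..k} \<union> s ` {e..l}) = k + (l + 1 - e)"
      by (subst card_chains[OF t s(1)]) (use dis in auto)
    have "t ` {1..k} \<union> s ` {e..l} \<subseteq> T" using chain_T[OF t] chain_T[OF s(1)] k by auto
    then have "k + (l + 1 - e) \<le> card T" using c card_mono[OF finite_T] by metis
    then show False using card_T b(3) k r_ge unfolding l_def[symmetric] e_def by linarith
  qed
  then show ?thesis using a_max[OF yV] by simp
qed

text \<open>The size of \<open>T\<close> and \<open>far_layer\<close> leave two disjoint chains,
  ending at layers \<open>r - 2\<close> or \<open>r - 1\<close> and \<open>r - 2\<close>. The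
  assumption \<open>avoid\<close> excludes an extra vertex of \<open>T\<close> beside two chains
  ending at layer \<open>r - 2\<close>: each \<open>x\<close> missing all of \<open>T\<close> would
  then also miss the vertex outside \<open>T\<close> nearest to a vertex at distance
  \<open>r\<close> or more from \<open>x\<close>.\<close>

lemma two_chains_cases:
  assumes avoid: "card missing < (2 * r - 2) * card {x \<in> V - T. out_missed x \<supseteq> T}"
  obtains (even) t s where "chain t (r - 2)" "chain s (r - 2)"
      "T = t ` {1..r - 2} \<union> s ` {1..r - 2}" "card T = 2 * r - 4" "\<And>x. x \<in> V \<Longrightarrow> layer x \<le> r - 2"
    | (uneven) t s where "chain t (r - 1)" "chain s (r - 2)"
      "T = t ` {1..r - 1} \<union> s ` {1..r - 2}" "card T = 2 * r - 3"
      "\<And>j. j \<le> r - 2 \<Longrightarrow> t j \<noteq> s j"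
proof -
  obtain a where a: "a \<in> V" and a_max: "\<And>z. z \<in> V \<Longrightarrow> layer z \<le> layer a"
    using ex_maximum[OF finite_V, of layer] T_proper by auto
  define k where "k = layer a"
  have k: "r - 2 \<le> k" "k < r" using far_layer[OF a] a_max layer_less[OF a] by (fastforce simp: k_def)+
  obtain t where t: "chain t k" using ex_chain[OF a] by (auto simp: k_def)
  have u: "t 0 \<in> V" using chain_V[OF t] k by simp
  obtain b where b: "b \<in> V" "r \<le> d (t 0) b" "r - 2 \<le> layer b" using far_layer[OF u] by blast
  define l where "l = layer b"
  obtain s where s: "chain s l" "s l = b" using ex_chain[OF b(1)] by (auto simp: l_def)
  have lk: "l \<le> k" "r - 2 \<le> l" using a_max[OF b(1)] b by (simp_all add: l_def k_def)
  have "l < r" using lk k by simp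
  then have dis: "t j \<noteq> s j" if "j \<le> l" for j
    using chains_disjoint[OF t s(1), of 0 j] that lk b(2) s(2) by simp
  have c: "card (t ` {1..k} \<union> s ` {1..l}) = k + l"
    by (subst card_chains[OF t s(1)]) (use dis in auto)
  have sub: "t ` {1..k} \<union> s ` {1..l} \<subseteq> T" using chain_T[OF t] chain_T[OF s(1)] by auto
  then have kl: "k + l \<le> card T" using c card_mono[OF finite_T] by metis
  then have l: "l = r - 2" using card_T lk k by linarith
  have kcases: "k = r - 2 \<or> k = r - 1" using k by linarith
  show thesis
  proof (cases "k = r - 1")
    case True
    then have "card T = 2 * r - 3" using kl l card_T r_ge by linarith
    moreover have "T = t ` {1..k} \<union> s ` {1..l}"
      using card_subset_eq[OF finite_T sub] c calculation True l r_ge by simp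
    ultimately show thesis using uneven[of t s] t s b dis True l by simp
  next
    case False
    then have k2: "k = r - 2" using kcases by simp
    have "card T \<noteq> 2 * r - 3"
    proof
      assume cT: "card T = 2 * r - 3"
      let ?A = "{x \<in> V - T. out_missed x \<supseteq> T}"
      have "2 * r - 2 \<le> card (out_missed x)" if x: "x \<in> ?A" for x
      proof -
        obtain y where y: "y \<in> V" "r \<le> d x y" using far x by blast
        obtain w where w: "w \<in> V - T" "d w y = layer y" using layer_attained by blast
        have "d x y \<le> d x w + layer y" using gdist_triangle[of x w y] w x y by auto
        then have "2 \<le> d x w" using y a_max[OF y(1)] k2 r_ge unfolding k_def by linarith
        then have "insert w T \<subseteq> out_missed x" using mem_out_missed[of x w] x w by auto
        moreover have "card (insert w T) = 2 * r - 2" using w cT r_ge by simp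
        ultimately show ?thesis using card_mono[OF finite_out_missed] by metis
      qed
      then have "(2 * r - 2) * card ?A \<le> (\<Sum>x\<in>?A. card (out_missed x))"
        using sum_mono[of ?A "\<lambda>_. 2 * r - 2"] by (simp add: mult.commute)
      also have "\<dots> \<le> (\<Sum>x\<in>V. card (out_missed x))" using finite_V by (intro sum_mono2) auto
      also have "\<dots> = card missing" by (simp add: card_missing_out_missed)
      finally show False using avoid by simp
    qed
    then have cT: "card T = 2 * r - 4" using kl k2 l card_T r_ge by linarith
    have "T = t ` {1..k} \<union> s ` {1..l}"
      using card_subset_eq[OF finite_T sub] c cT k2 l r_ge by simp
    then have "T = t ` {1..r - 2} \<union> s ` {1..r - 2}" unfolding k2 l .
    moreover have "layer x \<le> r - 2" if "x \<in> V" for x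
      using a_max[OF that] unfolding k_def[symmetric] k2 .
    ultimately show thesis using even[of t s] t[unfolded k2] s(1)[unfolded l] cT by blast
  qed
qed

end

section \<open>Counting with two targets\<close>

text \<open>The shape of the distances \<open>f\<close>, \<open>g\<close> to the two targets in an
  extremal digraph. Level \<open>r - 1\<close> may have any size: for \<open>f\<close> and
  \<open>g\<close> it consists of the copies of v_1 and of w_1.\<close>

definition two_sided :: "nat \<Rightarrow> 'a set \<Rightarrow> ('a \<Rightarrow> nat) \<Rightarrow> ('a \<Rightarrow> nat) \<Rightarrow> bool" where
  "two_sided r U f g \<longleftrightarrow> finite U \<and>
     (\<forall>j. j + 2 \<le> r \<longrightarrow> card {x \<in> U. f x = j} = 1 \<and> card {x \<in> U. g x = j} = 1) \<and>
     (\<forall>x\<in>U. f x < r \<longleftrightarrow> r \<le> g x)"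

text \<open>If \<open>f\<close> is the distance to a fixed vertex, these pairs are not arcs, since
  an arc lowers \<open>f\<close> by at most 1. The condition \<open>f z + 2 \<le> r\<close> amounts
  to truncating \<open>f\<close> at \<open>r\<close>.\<close>

definition far_pairs :: "nat \<Rightarrow> 'a set \<Rightarrow> ('a \<Rightarrow> nat) \<Rightarrow> ('a \<times> 'a) set" where
  "far_pairs r U f = {(x, z). x \<in> U \<and> z \<in> U \<and> f z + 2 \<le> f x \<and> f z + 2 \<le> r}"

lemma finite_far_pairs [simp]: "finite U \<Longrightarrow> finite (far_pairs r U f)"
  by (rule finite_subset[of _ "U \<times> U"]) (auto simp: far_pairs_def)

text \<open>The pairs are grouped by the level of \<open>z\<close>. Levels up to
  \<open>r - 3\<close> are singletons; the size of level \<open>r - 2\<close> remains a parameter.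
  Doubling avoids a division.\<close>

lemma card_far_pairs:
  fixes f :: "'a \<Rightarrow> nat"
  assumes U: "finite U" and r: "4 \<le> r"
    and level: "\<And>j. j + 3 \<le> r \<Longrightarrow> card {x \<in> U. f x = j} = 1"
  shows "2 * int (card (far_pairs r U f)) =
    2 * (int r - 3) * int (card U) - (int r - 2) * (int r - 1) + 2
    + 2 * (int (card U) - (int r - 2) - int (card {x \<in> U. f x + 2 = r}))
    + 2 * int (card {x \<in> U. f x + 2 = r}) * int (card {x \<in> U. r \<le> f x})"
proof -
  define p where "p = card {x \<in> U. f x + 2 = r}"
  define e where "e = card {x \<in> U. r \<le> f x}"
  define N where "N j = card {x \<in> U. j \<le> f x}" for j
  define Z where "Z j = {z \<in> U. f z = j}" for j
  have NS: "N j = card (Z j) + N (Suc j)" for j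
  proof -
    have "{x \<in> U. j \<le> f x} = Z j \<union> {x \<in> U. Suc j \<le> f x}" by (auto simp: Z_def)
    moreover have "card (Z j \<union> {x \<in> U. Suc j \<le> f x}) = card (Z j) + N (Suc j)"
      unfolding N_def by (rule card_Un_disjoint) (use U in \<open>auto simp: Z_def\<close>)
    ultimately show ?thesis by (simp add: N_def)
  qed
  have N0: "N 0 = card U" by (simp add: N_def)
  have Nj: "N j + j = card U" if "j + 2 \<le> r" for j
    using that
  proof (induction j)
    case (Suc j)
    then show ?case using NS[of j] level[of j] by (simp add: Z_def)
  qed (simp add: N0)
  have Np: "N (r - 1) + (r - 2) + p = card U"
  proof -
    have "Z (r - 2) = {x \<in> U. f x + 2 = r}" using r by (auto simp: Z_def)
    moreover have "Suc (r - 2) = r - 1" using r by simp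
    ultimately show ?thesis using NS[of "r - 2"] Nj[of "r - 2"] r by (simp add: p_def)
  qed
  have Ne: "N r = e" by (simp add: N_def e_def)
  have fp: "far_pairs r U f = (\<Union>j\<in>{..r - 2}. {x \<in> U. j + 2 \<le> f x} \<times> Z j)"
    using r by (auto simp: far_pairs_def Z_def)
  have "card (far_pairs r U f) = (\<Sum>j\<in>{..r - 2}. card ({x \<in> U. j + 2 \<le> f x} \<times> Z j))"
    unfolding fp by (rule card_UN_disjoint) (use U in \<open>auto simp: Z_def\<close>)
  also have "\<dots> = (\<Sum>j\<in>{..r - 2}. N (j + 2) * card (Z j))"
    by (simp add: card_cartesian_product N_def)
  also have "{..r - 2} = insert (r - 2) (insert (r - 3) {..<r - 3})" using r by auto
  also have "(\<Sum>j\<in>\<dots>. N (j + 2) * card (Z j)) =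
      N r * card (Z (r - 2)) + N (r - 1) * card (Z (r - 3)) + (\<Sum>j<r - 3. N (j + 2) * card (Z j))"
  proof -
    have "r - 2 + 2 = r" "r - 3 + 2 = r - 1" "r - 2 \<noteq> r - 3" using r by auto
    then show ?thesis by simp
  qed
  also have "card (Z (r - 3)) = 1" using level[of "r - 3"] r by (simp add: Z_def)
  also have "card (Z (r - 2)) = p" using r unfolding p_def Z_def by (intro arg_cong[of _ _ card]) auto
  also have "(\<Sum>j<r - 3. N (j + 2) * card (Z j)) = (\<Sum>j<r - 3. N (j + 2))"
    by (rule sum.cong) (use level in \<open>auto simp: Z_def\<close>)
  finally have c: "card (far_pairs r U f) = e * p + N (r - 1) + (\<Sum>j<r - 3. N (j + 2))"
    using Ne by simp
  have S: "2 * int (\<Sum>j<k. N (j + 2)) = 2 * int k * int (card U) - int k * (int k + 3)"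
    if "k + 3 \<le> r" for k
    using that
  proof (induction k)
    case (Suc k)
    have "int (N (k + 2)) = int (card U) - (int k + 2)" using Nj[of "k + 2"] Suc.prems by linarith
    then show ?case using Suc by (simp add: algebra_simps)
  qed simp
  have "int (r - 3) = int r - 3" using r by simp
  then have S': "2 * int (\<Sum>j<r - 3. N (j + 2)) = 2 * (int r - 3) * int (card U) - (int r - 3) * int r"
    using S[of "r - 3"] r by simp
  have Np': "int (N (r - 1)) = int (card U) - (int r - 2) - int p" using Np r by linarith
  have "2 * int (card (far_pairs r U f)) = 2 * (int e * int p) + 2 * int (N (r - 1))
      + 2 * int (\<Sum>j<r - 3. N (j + 2))"
    unfolding c by simp
  then show ?thesis
    unfolding p_def[symmetric] e_def[symmetric] S' Np' by (simp add: algebra_simps)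
qed

context eccentric_digraph
begin

lemma far_pairs_missing: "a \<in> V \<Longrightarrow> far_pairs r V (\<lambda>x. d x a) \<subseteq> missing"
proof
  fix w assume a: "a \<in> V" and "w \<in> far_pairs r V (\<lambda>x. d x a)"
  then obtain x z where w: "w = (x, z)" "x \<in> V" "z \<in> V" "d z a + 2 \<le> d x a"
    by (auto simp: far_pairs_def)
  then have "(x, z) \<notin> E" using gdist_edge_triangle[of x z a] a by auto
  moreover have "x \<noteq> z" using w by auto
  ultimately show "w \<in> missing" using w by (simp add: missing_def)
qed

lemma levels_inhabited:
  assumes "x \<in> V" "a \<in> V" "j \<le> d x a"
  shows "\<exists>z\<in>V. d z a = j"
proof -
  obtain p where p: "geodesic p x a" using ex_geodesic assms by blast
  then show ?thesis
    using geodesic_V[OF p, of "d x a - j"] geodesic_dist_end[OF p, of "d x a - j"] assms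
    by (intro bexI[of _ "p (d x a - j)"]) auto
qed

lemma card_levels_le:
  assumes "\<And>j. j \<le> k \<Longrightarrow> \<exists>z\<in>V. f z = j"
  shows "k + 1 \<le> card {x \<in> V. f x \<le> (k::nat)}"
    and "card {x \<in> V. f x \<le> k} \<le> k + 1 \<Longrightarrow> j \<le> k \<Longrightarrow> card {x \<in> V. f x = j} = 1"
proof -
  have u: "{x \<in> V. f x \<le> k} = (\<Union>j\<in>{..k}. {x \<in> V. f x = j})" by auto
  have *: "(\<Sum>j\<le>k. card {x \<in> V. f x = j}) = card {x \<in> V. f x \<le> k}"
    unfolding u by (rule card_UN_disjoint[symmetric]) (use finite_V in auto)
  have pos: "1 \<le> card {x \<in> V. f x = j}" if "j \<le> k" for j
    using assms[OF that] finite_V by (auto simp: Suc_le_eq card_gt_0_iff)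
  show "k + 1 \<le> card {x \<in> V. f x \<le> k}"
    unfolding *[symmetric] using sum_mono[of "{..k}" "\<lambda>_. 1", OF pos] by simp
  show "card {x \<in> V. f x = j} = 1" if "card {x \<in> V. f x \<le> k} \<le> k + 1" "j \<le> k"
  proof (rule ccontr)
    assume "card {x \<in> V. f x = j} \<noteq> 1"
    then have "1 < card {x \<in> V. f x = j}" using pos[OF that(2)] by simp
    then have "(\<Sum>j\<le>k. 1) < (\<Sum>j\<le>k. card {x \<in> V. f x = j})"
      using pos that by (intro sum_strict_mono_ex1) auto
    then show False using * that by simp
  qed
qed

text \<open>The vertices within distance \<open>r - 3\<close> to \<open>a\<close> or to
  \<open>b\<close> must fill \<open>T\<close>, so these levels are singletons. The number of far
  pairs is then \<open>extremal_missing n r\<close> plus the nonnegative terms \<open>X\<close>,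
  \<open>Y\<close> and \<open>ea + eb - n\<close>, all of which vanish in the case of
  equality.\<close>

lemma two_targets:
  assumes ab: "a \<in> V" "b \<in> V"
    and cover: "\<And>x. x \<in> V \<Longrightarrow> r \<le> d x a \<or> r \<le> d x b"
    and T: "finite T" "card T \<le> 2 * r - 4"
    and aT: "\<And>x. \<lbrakk>x \<in> V; d x a + 3 \<le> r\<rbrakk> \<Longrightarrow> x \<in> T"
    and bT: "\<And>x. \<lbrakk>x \<in> V; d x b + 3 \<le> r\<rbrakk> \<Longrightarrow> x \<in> T"
  shows "extremal_missing n r \<le> int (card missing)"
    and "int (card missing) \<le> extremal_missing n r \<Longrightarrow>
      missing = far_pairs r V (\<lambda>x. d x a) \<union> far_pairs r V (\<lambda>x. d x b) \<and>
      two_sided r V (\<lambda>x. d x a) (\<lambda>x. d x b) \<and> (\<exists>x\<in>V. d x a = r - 1) \<and> (\<exists>x\<in>V. d x b = r - 1)"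
proof -
  have ba: "r \<le> d b a" "r \<le> d a b" using cover[OF ab(1)] cover[OF ab(2)] r_ge by auto
  have la: "\<exists>z\<in>V. d z a = j" if "j \<le> r" for j using levels_inhabited[of b a j] ab ba that by simp
  have lb: "\<exists>z\<in>V. d z b = j" if "j \<le> r" for j using levels_inhabited[of a b j] ab ba that by simp
  define A where "A = {x \<in> V. d x a \<le> r - 3}"
  define B where "B = {x \<in> V. d x b \<le> r - 3}"
  have fin: "finite A" "finite B" using finite_V by (auto simp: A_def B_def)
  have rw: "x \<le> r - 3 \<longleftrightarrow> x + 3 \<le> r" for x using r_ge by auto
  have "A \<union> B \<subseteq> T" using aT bT by (auto simp: A_def B_def rw)
  moreover have "A \<inter> B = {}" using cover r_ge by (force simp: A_def B_def)
  ultimately have AB: "card A + card B \<le> 2 * r - 4"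
    using card_mono[OF T(1), of "A \<union> B"] T(2) card_Un_disjoint[OF fin] by simp
  have "r - 3 + 1 \<le> card A" "r - 3 + 1 \<le> card B"
    unfolding A_def B_def using la lb by (intro card_levels_le(1); force)+
  then have cA: "card A \<le> r - 3 + 1" and cB: "card B \<le> r - 3 + 1" using AB r_ge by linarith+
  have lev_a: "card {x \<in> V. d x a = j} = 1" if "j + 3 \<le> r" for j
    using cA that la unfolding A_def rw[symmetric] by (intro card_levels_le(2)[of "r - 3"]) auto
  have lev_b: "card {x \<in> V. d x b = j} = 1" if "j + 3 \<le> r" for j
    using cB that lb unfolding B_def rw[symmetric] by (intro card_levels_le(2)[of "r - 3"]) auto
  let ?FA = "far_pairs r V (\<lambda>x. d x a)" and ?FB = "far_pairs r V (\<lambda>x. d x b)"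
  define p where "p = card {x \<in> V. d x a + 2 = r}"
  define q where "q = card {x \<in> V. d x b + 2 = r}"
  define ea where "ea = card {x \<in> V. r \<le> d x a}"
  define eb where "eb = card {x \<in> V. r \<le> d x b}"
  \<comment> \<open>The head of a common pair would be within distance \<open>r - 2\<close> to both
    targets.\<close>
  have dis: "?FA \<inter> ?FB = {}"
  proof -
    have False if "(x, z) \<in> ?FA \<inter> ?FB" for x z
      using that cover[of z] r_ge by (auto simp: far_pairs_def)
    then show ?thesis by auto
  qed
  have sub: "?FA \<union> ?FB \<subseteq> missing" using far_pairs_missing ab by blast
  define X where "X = (int p - 1) * (int ea - 1)"
  define Y where "Y = (int q - 1) * (int eb - 1)"
  have cF: "int (card (?FA \<union> ?FB)) = extremal_missing n r + X + Y + (int ea + int eb - int n)"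
  proof -
    have "int (card (?FA \<union> ?FB)) = int (card ?FA) + int (card ?FB)"
      using dis finite_V by (simp add: card_Un_disjoint)
    moreover note card_far_pairs[of V r "\<lambda>x. d x a", OF finite_V r_ge lev_a, folded p_def ea_def]
      card_far_pairs[of V r "\<lambda>x. d x b", OF finite_V r_ge lev_b, folded q_def eb_def]
    ultimately show ?thesis by (simp add: extremal_missing_def X_def Y_def algebra_simps)
  qed
  have p1: "1 \<le> p" "1 \<le> q"
  proof -
    have "r - 2 \<le> r" "r - 2 + 2 = r" using r_ge by auto
    then show "1 \<le> p" "1 \<le> q" unfolding p_def q_def using la[of "r - 2"] lb[of "r - 2"] finite_V
      by (auto simp: Suc_le_eq card_gt_0_iff)
  qed
  \<comment> \<open>Vertices within distance 1 to one target are far from the other. The bound 2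
    makes the second factors of \<open>X\<close> and \<open>Y\<close> positive, so that equality
    gives \<open>p = 1\<close> and \<open>q = 1\<close>.\<close>
  have e2: "2 \<le> ea" "2 \<le> eb"
  proof -
    have "{x \<in> V. d x b \<le> 1} \<subseteq> {x \<in> V. r \<le> d x a}" "{x \<in> V. d x a \<le> 1} \<subseteq> {x \<in> V. r \<le> d x b}"
      using cover r_ge by force+
    then have "card {x \<in> V. d x b \<le> 1} \<le> ea" "card {x \<in> V. d x a \<le> 1} \<le> eb"
      unfolding ea_def eb_def using finite_V by (auto intro: card_mono)
    moreover have "1 + 1 \<le> card {x \<in> V. d x b \<le> 1}" "1 + 1 \<le> card {x \<in> V. d x a \<le> 1}"
      using la lb r_ge by (intro card_levels_le(1); force)+
    ultimately show "2 \<le> ea" "2 \<le> eb" by linarith+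
  qed
  have en: "n \<le> ea + eb"
  proof -
    have "V = {x \<in> V. r \<le> d x a} \<union> {x \<in> V. r \<le> d x b}" using cover by auto
    then show ?thesis unfolding ea_def eb_def
      using card_Un_le[of "{x \<in> V. r \<le> d x a}" "{x \<in> V. r \<le> d x b}"] by simp
  qed
  have nn: "0 \<le> X" "0 \<le> Y" using p1 e2 by (simp_all add: X_def Y_def)
  have cm: "card (?FA \<union> ?FB) \<le> card missing" by (rule card_mono) (use sub in simp_all)
  show "extremal_missing n r \<le> int (card missing)" using cF cm nn en by linarith
  assume le: "int (card missing) \<le> extremal_missing n r"
  then have cme: "card missing = card (?FA \<union> ?FB)"
    and z: "X = 0" "Y = 0"
    and een: "ea + eb = n"
    using cF cm nn en by linarith+
  have pq: "p = 1" "q = 1" using z e2 by (auto simp: X_def Y_def)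
  have m: "missing = ?FA \<union> ?FB" using card_subset_eq[OF finite_missing sub] cme by simp
  have "card {x \<in> V. d x a = j} = 1 \<and> card {x \<in> V. d x b = j} = 1" if "j + 2 \<le> r" for j
  proof (cases "j + 2 = r")
    case True
    then have "x + 2 = r \<longleftrightarrow> x = j" for x by auto
    then show ?thesis using pq unfolding p_def q_def by simp
  qed (use that lev_a lev_b in auto)
  moreover have "d x a < r \<longleftrightarrow> r \<le> d x b" if x: "x \<in> V" for x
  proof -
    have "card ({x \<in> V. r \<le> d x a} \<inter> {x \<in> V. r \<le> d x b}) = 0"
    proof -
      have "V = {x \<in> V. r \<le> d x a} \<union> {x \<in> V. r \<le> d x b}" using cover by auto
      then show ?thesis
        using card_Un_Int[of "{x \<in> V. r \<le> d x a}" "{x \<in> V. r \<le> d x b}"] finite_V een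
        by (simp add: ea_def eb_def)
    qed
    then have "\<not> (r \<le> d x a \<and> r \<le> d x b)" using finite_V x by auto
    then show ?thesis using cover[OF x] by linarith
  qed
  ultimately show "missing = ?FA \<union> ?FB \<and>
      two_sided r V (\<lambda>x. d x a) (\<lambda>x. d x b) \<and> (\<exists>x\<in>V. d x a = r - 1) \<and> (\<exists>x\<in>V. d x b = r - 1)"
    using m la[of "r - 1"] lb[of "r - 1"] finite_V by (auto simp: two_sided_def)
qed

end

section \<open>A single deepest vertex\<close>

text \<open>One chain reaches layer \<open>r - 1\<close>. Every vertex is far from one of
  \<open>a\<close>, \<open>a'\<close> and \<open>b\<close>; the aim is that \<open>a\<close> and
  \<open>b\<close> suffice, or else too many arcs are missing.\<close>

locale uneven_layered_digraph = layered_digraph +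
  fixes t s :: "nat \<Rightarrow> 'a"
  assumes t_chain: "chain t (r - 1)" and s_chain: "chain s (r - 2)"
    and T_eq: "T = t ` {1..r - 1} \<union> s ` {1..r - 2}" and cT: "card T = 2 * r - 3"
    and t_s: "j \<le> r - 2 \<Longrightarrow> t j \<noteq> s j"
begin

abbreviation a :: 'a where "a \<equiv> t (r - 1)"
abbreviation a' :: 'a where "a' \<equiv> t (r - 2)"
abbreviation b :: 'a where "b \<equiv> s (r - 2)"

lemma t_V: "i \<le> r - 1 \<Longrightarrow> t i \<in> V" and s_V: "i \<le> r - 2 \<Longrightarrow> s i \<in> V"
  using chain_V t_chain s_chain by auto

lemma t_V': "i \<le> r - 2 \<Longrightarrow> t i \<in> V"
  by (rule t_V) simp

lemma ab_V: "a \<in> V" "a' \<in> V" "b \<in> V"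
  by (auto intro: t_V s_V)

lemma t_layer: "i \<le> r - 1 \<Longrightarrow> layer (t i) = i" and s_layer: "i \<le> r - 2 \<Longrightarrow> layer (s i) = i"
  using chain_layer t_chain s_chain by auto

lemma t_a: "i \<le> r - 1 \<Longrightarrow> d (t i) a = r - 1 - i"
  and t_a': "i \<le> r - 2 \<Longrightarrow> d (t i) a' = r - 2 - i"
  and s_b: "i \<le> r - 2 \<Longrightarrow> d (s i) b = r - 2 - i"
  using chain_dist[OF t_chain, of i] chain_dist[OF s_chain, of i] by auto

lemma a'_a: "d a' a \<le> 1"
  using t_a[of "r - 2"] r_ge by simp

lemma top_layer: "\<lbrakk>y \<in> V; r - 2 \<le> layer y\<rbrakk> \<Longrightarrow> y = a \<or> y = a' \<or> y = b"
proof -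
  assume y: "y \<in> V" "r - 2 \<le> layer y"
  then have "y \<in> T" using layer_eq_0[of y] r_ge by auto
  then consider i where "y = t i" "i \<le> r - 1" | i where "y = s i" "i \<le> r - 2"
    unfolding T_eq by auto
  then show ?thesis
  proof cases
    case 1
    then have "i = r - 1 \<or> i = r - 2" using t_layer y by auto
    then show ?thesis using 1 by auto
  next
    case 2
    then have "i = r - 2" using s_layer y by auto
    then show ?thesis using 2 by auto
  qed
qed

lemma far_top: "x \<in> V \<Longrightarrow> r \<le> d x a \<or> r \<le> d x a' \<or> r \<le> d x b"
  using far_layer[of x] top_layer by blast

lemma card_ts: "\<lbrakk>I \<subseteq> {..r - 1}; J \<subseteq> {..r - 2}\<rbrakk> \<Longrightarrow> card (t ` I \<union> s ` J) = card I + card J"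
  using t_s by (intro card_chains[OF t_chain s_chain]) auto

section \<open>Lower bounds for the out-defects of the chain vertices\<close>

lemma a_le: "x \<in> V \<Longrightarrow> d x a \<le> d x a' + 1"
  using gdist_triangle[of x a' a] ab_V a'_a by simp

text \<open>The chain leads from \<open>t j\<close> to both \<open>a\<close> and \<open>a'\<close>
  in fewer than \<open>r\<close> steps, so only \<open>b\<close> can be far.\<close>

lemma t_b: "j \<le> r - 2 \<Longrightarrow> r \<le> d (t j) b"
  using far_top[of "t j"] t_V[of j] t_a[of j] t_a'[of j] r_ge by auto

text \<open>The chain \<open>s\<close> needs only \<open>r - 2 - i\<close> steps from
  \<open>s i\<close> to \<open>b\<close>, so \<open>x\<close> misses all of it, including
  \<open>s 0\<close>; from the other chain it misses what lies beyond index
  \<open>j + 1\<close>.\<close>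

lemma out_missed_t:
  assumes x: "x \<in> V" "r \<le> d x b" and j: "j \<le> r - 2"
    and t: "\<And>i. \<lbrakk>j + 2 \<le> i; i \<le> r - 1\<rbrakk> \<Longrightarrow> 2 \<le> d x (t i)"
  shows "2 * r - 3 - j \<le> card (out_missed x)"
proof -
  have "card (t ` {j + 2..r - 1} \<union> s ` {0..r - 2}) \<le> card (out_missed x)"
  proof (rule card_out_missed_geI[OF x(1)])
    fix y assume "y \<in> t ` {j + 2..r - 1} \<union> s ` {0..r - 2}"
    then consider i where "y = t i" "j + 2 \<le> i" "i \<le> r - 1" | i where "y = s i" "i \<le> r - 2" by auto
    then show "y \<in> V \<and> 2 \<le> d x y"
    proof cases
      case 1 then show ?thesis using t t_V by auto
    next
      case 2
      then have "r \<le> d x y + (r - 2 - i)"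
        using x gdist_triangle[of x y b] s_V[of i] s_b[of i] ab_V by simp
      then show ?thesis using 2 s_V r_ge by auto
    qed
  qed
  also have "card (t ` {j + 2..r - 1} \<union> s ` {0..r - 2}) = (r - 1 - (j + 1)) + (r - 1)"
    using r_ge by (subst card_ts) auto
  finally show ?thesis using j r_ge by linarith
qed

lemma out_missed_t_chain: "j \<le> r - 2 \<Longrightarrow> 2 * r - 3 - j \<le> card (out_missed (t j))"
  using t_V[of j] t_b[of j] t_layer[of j] chain_dist[OF t_chain, of j] by (intro out_missed_t) auto

lemma s_a': "j \<le> r - 3 \<Longrightarrow> r - 1 \<le> d (s j) a'"
  using far_top[of "s j"] s_V[of j] a_le[of "s j"] s_b[of j] r_ge by auto

text \<open>\<open>i\<close> is the permitted shortfall of the distance to \<open>a'\<close> below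
  \<open>r\<close>: for \<open>i = 0\<close> even \<open>t 0\<close> is missed. The vertex
  \<open>a\<close> lies beyond \<open>a'\<close> and is handled through its layer.\<close>

lemma out_missed_s_aux:
  assumes j: "1 \<le> j" "j \<le> r - 3" and i: "i \<le> 1" "r - i \<le> d (s j) a'"
  shows "2 * r - 3 - j - i \<le> card (out_missed (s j))"
proof -
  have sV: "s j \<in> V" using s_V j by simp
  have "card (t ` {i..r - 1} \<union> s ` {j + 2..r - 2}) \<le> card (out_missed (s j))"
  proof (rule card_out_missed_geI[OF sV])
    fix y assume "y \<in> t ` {i..r - 1} \<union> s ` {j + 2..r - 2}"
    moreover have "{i..r - 1} = insert (r - 1) {i..r - 2}" using i r_ge by auto
    ultimately consider k where "y = t k" "i \<le> k" "k \<le> r - 2" | "y = a"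
      | k where "y = s k" "j + 2 \<le> k" "k \<le> r - 2"
      by auto
    then show "y \<in> V \<and> 2 \<le> d (s j) y"
    proof cases
      case 1
      then have "r - i \<le> d (s j) y + (r - 2 - k)"
        using i gdist_triangle[OF sV t_V'[of k] ab_V(2)] t_a'[of k] by simp
      then show ?thesis using 1 t_V' i r_ge by auto
    next
      case 2
      then have "r - 1 \<le> j + d (s j) y"
        using layer_triangle[OF sV ab_V(1)] s_layer[of j] t_layer[of "r - 1"] j by simp
      then show ?thesis using 2 j r_ge ab_V by auto
    next
      case 3
      then show ?thesis using chain_dist[OF s_chain, of j k] s_V by auto
    qed
  qed
  also have "card (t ` {i..r - 1} \<union> s ` {j + 2..r - 2}) = (r - i) + (r - 2 - (j + 1))"
    using r_ge by (subst card_ts) auto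
  finally show ?thesis using j i r_ge by linarith
qed

lemma out_missed_s: "\<lbrakk>1 \<le> j; j \<le> r - 3\<rbrakk> \<Longrightarrow> 2 * r - 4 - j \<le> card (out_missed (s j))"
  using out_missed_s_aux[of j 1] s_a'[of j] by simp

text \<open>The arc from \<open>b\<close> to \<open>a\<close> brings \<open>a\<close>, like
  \<open>b\<close>, within \<open>r - 1\<close> steps of \<open>s j\<close>. So \<open>a'\<close> is
  the far vertex, and no shortfall occurs.\<close>

lemma out_missed_s_ba:
  assumes "(b, a) \<in> E" "1 \<le> j" "j \<le> r - 3"
  shows "2 * r - 3 - j \<le> card (out_missed (s j))"
proof -
  have "d (s j) a \<le> Suc (d (s j) b)" using assms s_V by (intro gdist_edge_triangle') auto
  then have "r \<le> d (s j) a'"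
    using far_top[of "s j"] s_V[of j] s_b[of j] assms r_ge by auto
  then show ?thesis using out_missed_s_aux[of j 0] assms by simp
qed

text \<open>\<open>a\<close> misses the rest of its own chain since \<open>a'\<close> is far, and
  the other chain since \<open>b\<close> is at most one step closer to \<open>a\<close> than to
  \<open>a'\<close>.\<close>

lemma out_missed_a:
  assumes "r \<le> d a a'"
  shows "2 * r - 3 \<le> card (out_missed a)"
proof -
  have "r \<le> d a' a + d a b"
    using t_b[of "r - 2"] gdist_triangle[OF ab_V(2,1,3)] by simp
  then have ab: "r - 1 \<le> d a b" using a'_a by linarith
  have "card (t ` {0..r - 2} \<union> s ` {1..r - 2}) \<le> card (out_missed a)"
  proof (rule card_out_missed_geI[OF ab_V(1)])
    fix y assume "y \<in> t ` {0..r - 2} \<union> s ` {1..r - 2}"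
    then consider k where "y = t k" "k \<le> r - 2" | k where "y = s k" "1 \<le> k" "k \<le> r - 2" by auto
    then show "y \<in> V \<and> 2 \<le> d a y"
    proof cases
      case 1
      then have "r \<le> d a y + (r - 2 - k)"
        using assms gdist_triangle[OF ab_V(1) t_V'[of k] ab_V(2)] t_a'[of k] by simp
      then show ?thesis using 1 t_V' r_ge by auto
    next
      case 2
      then have "r - 1 \<le> d a (s k) + (r - 2 - k)"
        using ab gdist_triangle[OF ab_V(1) s_V[OF 2(3)] ab_V(3)] s_b[OF 2(3)] by linarith
      then show ?thesis using 2 s_V r_ge by auto
    qed
  qed
  also have "card (t ` {0..r - 2} \<union> s ` {1..r - 2}) = (r - 1) + (r - 2)"
    using r_ge by (subst card_ts) auto
  finally show ?thesis using r_ge by linarith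
qed

text \<open>Vertices with an arc to \<open>s 1\<close> may miss one vertex too few, but \<open>t 0\<close> misses all of them.\<close>

lemma sum_out_missed_outside: "(2 * r - 3) * card (V - T) \<le> (\<Sum>x\<in>V - T. card (out_missed x)) + 1"
proof -
  define W where "W = {x \<in> V - T. (x, s 1) \<in> E}"
  define U where "U = V - T - W - {t 0}"
  have fin: "finite W" "finite U" using finite_V by (auto simp: W_def U_def)
  have t0: "t 0 \<in> V - T" using chain_T[OF t_chain, of 0] t_V by auto
  have r1: "1 \<le> r - 2" "1 \<le> r - 1" using r_ge by auto
  have s1_b: "d (s 1) b = r - 3" and t1_a: "d (t 1) a = r - 2" and t1_a': "d (t 1) a' = r - 3"
    using s_b[OF r1(1)] t_a[OF r1(2)] t_a'[OF r1(1)] by auto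
  have t0W: "t 0 \<notin> W"
  proof
    assume "t 0 \<in> W"
    then have "d (t 0) b \<le> Suc (d (s 1) b)"
      using ab_V by (intro gdist_edge_triangle) (auto simp: W_def)
    then show False using t_b[of 0] s1_b r_ge by simp
  qed
  have split: "V - T = insert (t 0) (W \<union> U)" "t 0 \<notin> W \<union> U" "W \<inter> U = {}"
    using t0 t0W by (auto simp: U_def W_def)
  have miss_T: "2 \<le> d x y" if "x \<in> V - T" "y \<in> T" "(x, y) \<notin> E" for x y
  proof (rule ccontr)
    assume "\<not> ?thesis"
    then have "x = y \<or> (x, y) \<in> E" using that T_sub by (intro gdist_le_1) auto
    then show False using that by auto
  qed
  have layer_T: "(x, y) \<notin> E" if "x \<in> V - T" "y \<in> T" "y \<noteq> t 1" "y \<noteq> s 1" for x y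
  proof
    assume "(x, y) \<in> E"
    then have "layer y \<le> 1" using layer_edge[of x y] layer_eq_0[of x] that by simp
    moreover have "layer y \<noteq> 1"
      using that(2-4) t_layer s_layer unfolding T_eq by auto
    moreover have "layer y \<noteq> 0" using layer_eq_0[of y] that(2) T_sub by auto
    ultimately show False by linarith
  qed
  \<comment> \<open>Arcs to both \<open>t 1\<close> and \<open>s 1\<close> would leave none of
    \<open>a\<close>, \<open>a'\<close>, \<open>b\<close> at distance \<open>r\<close> from
    \<open>x\<close>.\<close>
  have t1: "(x, t 1) \<notin> E" if "x \<in> W" for x
  proof
    assume e: "(x, t 1) \<in> E"
    have xV: "x \<in> V" and e': "(x, s 1) \<in> E" using that by (auto simp: W_def)
    have "d x a \<le> Suc (d (t 1) a)" "d x a' \<le> Suc (d (t 1) a')" "d x b \<le> Suc (d (s 1) b)"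
      using e e' ab_V by (auto intro: gdist_edge_triangle)
    then show False using far_top[OF xV] t1_a t1_a' s1_b r_ge by linarith
  qed
  have omW: "2 * r - 4 \<le> card (out_missed x)" if x: "x \<in> W" for x
  proof -
    have "card (T - {s 1}) \<le> card (out_missed x)"
    proof (rule card_out_missed_geI)
      show "x \<in> V" using x by (simp add: W_def)
      fix y assume y: "y \<in> T - {s 1}"
      then have "(x, y) \<notin> E" using layer_T[of x y] t1[OF x] x by (cases "y = t 1") (auto simp: W_def)
      then show "y \<in> V \<and> 2 \<le> d x y" using miss_T[of x y] x y T_sub by (auto simp: W_def)
    qed
    then show ?thesis using card_Diff_singleton_if[of T "s 1"] cT by (auto split: if_splits)
  qed
  have omU: "2 * r - 3 \<le> card (out_missed x)" if x: "x \<in> U" for x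
  proof (cases "(x, t 1) \<in> E")
    case True
    have xV: "x \<in> V - T" "x \<in> V" using x by (auto simp: U_def)
    have "d x a \<le> Suc (d (t 1) a)" "d x a' \<le> Suc (d (t 1) a')"
      using True ab_V by (auto intro: gdist_edge_triangle)
    then have "r \<le> d x b" using far_top[OF xV(2)] t1_a t1_a' r_ge by linarith
    moreover have "2 \<le> d x (t i)" if "2 \<le> i" "i \<le> r - 1" for i
      using layer_triangle[OF xV(2) t_V[of i]] t_layer[of i] layer_eq_0[of x] xV that by simp
    ultimately show ?thesis using out_missed_t[of x 0] xV by simp
  next
    case False
    have "card T \<le> card (out_missed x)"
    proof (rule card_out_missed_geI)
      show "x \<in> V" using x by (simp add: U_def)
      fix y assume y: "y \<in> T"
      have "(x, y) \<notin> E" using layer_T[of x y] False x y by (auto simp: U_def W_def)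
      then show "y \<in> V \<and> 2 \<le> d x y" using miss_T[of x y] x y T_sub by (auto simp: U_def)
    qed
    then show ?thesis using cT by simp
  qed
  \<comment> \<open>Vertices of \<open>W\<close> have distance at most \<open>r - 2\<close> to
    \<open>b\<close>, while \<open>t 0\<close> has distance at least \<open>r\<close>. So
    \<open>t 0\<close> misses all of \<open>W\<close>, which pays one arc for each vertex of
    \<open>W\<close>.\<close>
  have om0: "card W + (2 * r - 4) \<le> card (out_missed (t 0))"
  proof -
    let ?S = "t ` {2..r - 1} \<union> s ` {1..r - 2}"
    have "?S \<subseteq> T" unfolding T_eq by auto
    then have "W \<inter> ?S = {}" by (auto simp: W_def)
    then have "card (W \<union> ?S) = card W + card ?S" using fin by (intro card_Un_disjoint) auto
    moreover have "card ?S = (r - 2) + (r - 2)" using r_ge by (subst card_ts) auto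
    moreover have "card (W \<union> ?S) \<le> card (out_missed (t 0))"
    proof (rule card_out_missed_geI)
      show "t 0 \<in> V" using t0 by simp
      fix y assume "y \<in> W \<union> ?S"
      then consider "y \<in> W" | i where "y = t i" "2 \<le> i" "i \<le> r - 1"
        | i where "y = s i" "1 \<le> i" "i \<le> r - 2" by auto
      then show "y \<in> V \<and> 2 \<le> d (t 0) y"
      proof cases
        case 1
        then have yV: "y \<in> V" and e: "(y, s 1) \<in> E" by (auto simp: W_def)
        have "d y b \<le> Suc (d (s 1) b)" using e ab_V by (intro gdist_edge_triangle)
        moreover have "r \<le> d (t 0) y + d y b"
          using gdist_triangle[OF t_V'[of 0] yV ab_V(3)] t_b[of 0] by simp
        ultimately show ?thesis using yV s1_b r_ge by auto
      next
        case 2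
        then show ?thesis using chain_dist[OF t_chain, of 0 i] t_V by auto
      next
        case 3
        then have "r \<le> d (t 0) y + (r - 2 - i)"
          using gdist_triangle[OF t_V'[of 0] s_V[OF 3(3)] ab_V(3)] t_b[of 0] s_b[OF 3(3)]
          unfolding 3(1) by linarith
        then show ?thesis using 3 s_V r_ge by auto
      qed
    qed
    ultimately show ?thesis using r_ge by linarith
  qed
  obtain c where c: "2 * r - 4 = c" "2 * r - 3 = Suc c" using r_ge by auto
  have "(\<Sum>x\<in>V - T. card (out_missed x)) = card (out_missed (t 0)) + ((\<Sum>x\<in>W. card (out_missed x)) + (\<Sum>x\<in>U. card (out_missed x)))"
    unfolding split(1) using split(2,3) fin by (simp add: sum.union_disjoint)
  moreover have "card W * c \<le> (\<Sum>x\<in>W. card (out_missed x))"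
    using sum_mono[of W "\<lambda>_. c"] omW c by simp
  moreover have "card U * Suc c \<le> (\<Sum>x\<in>U. card (out_missed x))"
    using sum_mono[of U "\<lambda>_. Suc c"] omU c by simp
  moreover have "card (V - T) = Suc (card W + card U)"
    unfolding split(1) using split(2,3) fin by (simp add: card_Un_disjoint)
  ultimately show ?thesis using om0 unfolding c by (simp add: algebra_simps)
qed

text \<open>Such an \<open>x\<close> is far from \<open>a'\<close> only, which forces an arc from
  \<open>b\<close> to \<open>a\<close> or \<open>r \<le> d a a'\<close>. In either case the sum of
  all out-defects exceeds \<open>extremal_missing n r\<close> by at least
  \<open>r - 3\<close>.\<close>

lemma uncovered_missing:
  assumes x: "x \<in> V" "d x a < r" "d x b < r"
  shows "extremal_missing n r < int (card missing)"
proof -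
  have xa': "r \<le> d x a'" using far_top[OF x(1)] x by simp
  have not_ba: "r \<le> d a a'" if nba: "(b, a) \<notin> E"
  proof -
    have "x = a"
    proof (rule ccontr)
      assume xa: "x \<noteq> a"
      then have pos: "d x a \<noteq> 0" using gdist_eq_0[OF x(1) ab_V(1)] by auto
      obtain p where p: "geodesic p x a" using ex_geodesic[OF x(1) ab_V(1)] by blast
      define w where "w = p (d x a - 1)"
      have w: "w \<in> V" "d x w = d x a - 1" "d w a = 1"
        using geodesic_V[OF p, of "d x a - 1"] geodesic_dist_0[OF p, of "d x a - 1"]
          geodesic_dist_end[OF p, of "d x a - 1"] pos by (auto simp: w_def)
      have "w \<noteq> a" using w(3) by auto
      then have wa: "(w, a) \<in> E" using gdist_le_1[OF w(1) ab_V(1)] w(3) by simp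
      \<comment> \<open>The predecessor \<open>w\<close> of \<open>a\<close> is a top vertex other
        than \<open>a\<close>; it is not \<open>b\<close> by assumption, and not \<open>a'\<close>
        since \<open>a'\<close> is far from \<open>x\<close>.\<close>
      then have "r - 2 \<le> layer w" using layer_edge[OF wa] t_layer[of "r - 1"] by simp
      then have "w = a' \<or> w = b" using top_layer[OF w(1)] \<open>w \<noteq> a\<close> by simp
      then show False using wa nba xa' w(2) x(2) by auto
    qed
    then show ?thesis using xa' by simp
  qed
  let ?S = "\<lambda>k. \<Sum>j\<in>{1..k}. int j"
  have S: "2 * ?S k = int k * (int k + 1)" for k
    by (induction k) (auto simp: algebra_simps)
  have r2: "int (r - 2) = int r - 2" "int (r - 3) = int r - 3" using r_ge by auto
  have t_sum: "(int r - 2) * (2 * int r - 3) - ?S (r - 2) \<le> (\<Sum>j\<in>{1..r - 2}. int (card (out_missed (t j))))"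
  proof -
    have "(\<Sum>j\<in>{1..r - 2}. 2 * int r - 3 - int j) \<le> (\<Sum>j\<in>{1..r - 2}. int (card (out_missed (t j))))"
    proof (rule sum_mono)
      fix j assume "j \<in> {1..r - 2}"
      then show "2 * int r - 3 - int j \<le> int (card (out_missed (t j)))" using out_missed_t_chain[of j] by auto
    qed
    then show ?thesis by (simp add: sum_subtractf r2)
  qed
  have s_sum: "(int r - 3) * (2 * int r - 3 - i) - ?S (r - 3) \<le> (\<Sum>j\<in>{1..r - 3}. int (card (out_missed (s j))))"
    if "\<And>j. \<lbrakk>1 \<le> j; j \<le> r - 3\<rbrakk> \<Longrightarrow> 2 * int r - 3 - i - int j \<le> int (card (out_missed (s j)))" for i
  proof -
    have "(\<Sum>j\<in>{1..r - 3}. 2 * int r - 3 - i - int j) \<le> (\<Sum>j\<in>{1..r - 3}. int (card (out_missed (s j))))"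
      using that by (intro sum_mono) auto
    then show ?thesis by (simp add: sum_subtractf r2)
  qed
  \<comment> \<open>One bound serves both cases: without the arc from \<open>b\<close> to
    \<open>a\<close> the vertices \<open>s j\<close> lose \<open>r - 3\<close> in total, but the
    bound for \<open>a\<close> grows by \<open>r - 2\<close>.\<close>
  have key: "(int r - 3) * (2 * int r - 3) - ?S (r - 3) + (int r - 1) + (int r - 1)
      \<le> (\<Sum>j\<in>{1..r - 3}. int (card (out_missed (s j)))) + int (card (out_missed a)) + int (card (out_missed b))"
  proof (cases "(b, a) \<in> E")
    case True
    have "2 * int r - 3 - 0 - int j \<le> int (card (out_missed (s j)))" if "1 \<le> j" "j \<le> r - 3" for j
      using out_missed_s_ba[OF True that] by linarith
    from s_sum[of 0, OF this] show ?thesis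
      using card_out_missed_ge[OF ab_V(1)] card_out_missed_ge[OF ab_V(3)] by (simp add: of_nat_diff) linarith
  next
    case False
    have "2 * int r - 3 - 1 - int j \<le> int (card (out_missed (s j)))" if "1 \<le> j" "j \<le> r - 3" for j
      using out_missed_s[OF that] by linarith
    from s_sum[of 1, OF this] show ?thesis
      using out_missed_a[OF not_ba[OF False]] card_out_missed_ge[OF ab_V(3)] r_ge
      by (simp add: algebra_simps) linarith
  qed
  have T_split: "(\<Sum>x\<in>T. int (card (out_missed x))) = (\<Sum>j\<in>{1..r - 2}. int (card (out_missed (t j)))) + int (card (out_missed a))
      + (\<Sum>j\<in>{1..r - 3}. int (card (out_missed (s j)))) + int (card (out_missed b))"
  proof -
    have inj: "inj_on t {1..r - 1}" "inj_on s {1..r - 2}"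
      using inj_on_subset[OF chain_inj[OF t_chain]] inj_on_subset[OF chain_inj[OF s_chain]] by auto
    have "card (t ` {1..r - 1} \<union> s ` {1..r - 2}) = card (t ` {1..r - 1}) + card (s ` {1..r - 2})"
      using card_ts[of "{1..r - 1}" "{1..r - 2}"] inj by (simp add: card_image)
    then have "t ` {1..r - 1} \<inter> s ` {1..r - 2} = {}"
      using card_Un_Int[of "t ` {1..r - 1}" "s ` {1..r - 2}"] by simp
    then have "(\<Sum>x\<in>T. int (card (out_missed x)))
        = (\<Sum>j\<in>{1..r - 1}. int (card (out_missed (t j)))) + (\<Sum>j\<in>{1..r - 2}. int (card (out_missed (s j))))"
      unfolding T_eq using inj by (simp add: sum.union_disjoint sum.reindex)
    moreover have "(\<Sum>j\<in>{1..r - 1}. f j) = (\<Sum>j\<in>{1..r - 2}. f j) + f (r - 1)"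
      "(\<Sum>j\<in>{1..r - 2}. f j) = (\<Sum>j\<in>{1..r - 3}. f j) + f (r - 2)" for f :: "nat \<Rightarrow> int"
    proof -
      have "r = Suc (Suc (Suc (r - 3)))" using r_ge by simp
      then obtain k where "r = Suc (Suc (Suc k))" by blast
      then show "(\<Sum>j\<in>{1..r - 1}. f j) = (\<Sum>j\<in>{1..r - 2}. f j) + f (r - 1)"
        "(\<Sum>j\<in>{1..r - 2}. f j) = (\<Sum>j\<in>{1..r - 3}. f j) + f (r - 2)" by simp_all
    qed
    ultimately show ?thesis by simp
  qed
  have "V = (V - T) \<union> T" using T_sub by auto
  then have "int (card missing) = (\<Sum>x\<in>V - T. int (card (out_missed x))) + (\<Sum>x\<in>T. int (card (out_missed x)))"
    unfolding card_missing_out_missed of_nat_sum using finite_V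
    by (metis (no_types, lifting) Diff_disjoint finite_Diff finite_T inf_commute sum.union_disjoint)
  moreover have "int (card (V - T)) = int n - (2 * int r - 3)"
    using card_Diff_subset[OF finite_T T_sub] card_mono[OF finite_V T_sub] cT r_ge by linarith
  moreover have "(2 * int r - 3) * int (card (V - T)) \<le> (\<Sum>x\<in>V - T. int (card (out_missed x))) + 1"
  proof -
    have "int (2 * r - 3) * int (card (V - T)) \<le> (\<Sum>x\<in>V - T. int (card (out_missed x))) + 1"
      using of_nat_mono[OF sum_out_missed_outside, where 'a = int] by simp
    then show ?thesis using r_ge by (simp add: of_nat_diff)
  qed
  ultimately have "(2 * int r - 3) * (int n - (2 * int r - 3)) - 1
      + ((int r - 2) * (2 * int r - 3) - ?S (r - 2))
      + ((int r - 3) * (2 * int r - 3) - ?S (r - 3) + (int r - 1) + (int r - 1)) \<le> int (card missing)"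
    using T_split t_sum key by simp
  then have "2 * ((2 * int r - 3) * (int n - (2 * int r - 3)) - 1
      + (int r - 2) * (2 * int r - 3) + (int r - 3) * (2 * int r - 3) + 2 * (int r - 1))
      - 2 * ?S (r - 2) - 2 * ?S (r - 3) \<le> 2 * int (card missing)"
    by simp
  then have "2 * extremal_missing n r + 2 * (int r - 2) - 2 \<le> 2 * int (card missing)"
    unfolding S r2 extremal_missing_def by (simp add: algebra_simps)
  then show ?thesis using r_ge by simp
qed

end

section \<open>Existence of the two targets\<close>

context eccentric_digraph
begin

text \<open>With \<open>T = low H\<close>, the vertices having an arc into \<open>T\<close> number
  at most \<open>card T * H\<close>. Hence almost all vertices miss the whole of \<open>T\<close>,
  which gives the second conclusion.\<close>

lemma layered_from_missing:
  assumes M: "int (card missing) \<le> extremal_missing n r" and n: "4096 * r ^ 8 + 16 * r ^ 2 < n"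
  obtains T where "layered_digraph V E r T"
    "card missing < (2 * r - 2) * card {x \<in> V - T. out_missed x \<supseteq> T}"
proof -
  have M': "card missing \<le> (2 * r - 3) * n"
  proof -
    have "0 \<le> (int r - 2) * (int r + 1)" using r_ge by simp
    then have "int (card missing) \<le> (2 * int r - 3) * int n"
      using M unfolding extremal_missing_def by linarith
    also have "\<dots> = int ((2 * r - 3) * n)" using r_ge by (simp add: of_nat_diff)
    finally show ?thesis unfolding of_nat_le_iff .
  qed
  obtain H where H: "\<And>x. x \<in> V \<Longrightarrow> card (out_missed x) \<le> H" and nH: "4 * r ^ 2 * (H + 1) < n"
    using out_missed_uniformly_small[OF M' n] by blast
  obtain c where c: "2 * r - 3 = c" "2 * r - 2 = Suc c" using r_ge by auto
  have c_n: "Suc c * (c * (H + 1)) < n" "Suc c * (H + 1) < n"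
  proof -
    have "Suc c * c \<le> (2 * r) * (2 * r)" by (intro mult_mono) (use c in linarith)+
    then have "(Suc c * c) * (H + 1) \<le> (4 * r ^ 2) * (H + 1)"
      by (intro mult_right_mono) (simp_all add: power2_eq_square)
    then show "Suc c * (c * (H + 1)) < n" using nH by (simp only: mult.assoc)
    moreover have "1 * (H + 1) \<le> c * (H + 1)" using c r_ge by (intro mult_right_mono) linarith+
    then have "Suc c * (H + 1) \<le> Suc c * (c * (H + 1))" by (intro mult_left_mono) simp_all
    ultimately show "Suc c * (H + 1) < n" by linarith
  qed
  have M'': "card missing \<le> c * n" using M' c by simp
  define T where "T = low H"
  have T_V: "T \<subseteq> V" by (auto simp: T_def low_def)
  have cT: "card T \<le> c"
  proof (rule ccontr)
    assume "\<not> ?thesis"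
    then have "Suc c * (n - (H + 1)) \<le> card T * (n - 1 - H)" by (intro mult_mono) auto
    also have "\<dots> \<le> c * n" using card_low[of H] M'' by (simp add: T_def)
    finally have "Suc c * n \<le> c * n + Suc c * (H + 1)" by (simp only: diff_mult_distrib2)
    then show False using c_n by simp
  qed
  have cn: "c < n"
  proof -
    have "c * 1 \<le> Suc c * (H + 1)" by (intro mult_mono) auto
    then show ?thesis using c_n by simp
  qed
  have "V - T \<noteq> {}"
    using cT cn card_mono[of T V] finite_V T_V by (metis Diff_eq_empty_iff finite_subset leD le_less_trans)
  moreover have "d x y \<le> 2" if "x \<in> V" "y \<in> V - T" for x y
    using card_in_nbrs_le_out_missed[of x y] H[of x] that by (force simp: T_def low_def)
  ultimately have "layered_digraph V E r T"
    using T_V cT c by unfold_locales auto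
  moreover have "card missing < (2 * r - 2) * card {x \<in> V - T. out_missed x \<supseteq> T}"
  proof -
    let ?A = "{x \<in> V - T. out_missed x \<supseteq> T}"
    have "V \<subseteq> ?A \<union> (T \<union> (\<Union>y\<in>T. in_nbrs y))"
      using T_V by (auto simp: out_missed_def in_nbrs_def)
    then have "n \<le> card (?A \<union> (T \<union> (\<Union>y\<in>T. in_nbrs y)))"
      using finite_V by (intro card_mono) (auto simp: T_def)
    also have "\<dots> \<le> card ?A + (card T + card (\<Union>y\<in>T. in_nbrs y))"
      by (meson card_Un_le add_left_mono le_trans)
    also have "card (\<Union>y\<in>T. in_nbrs y) \<le> (\<Sum>y\<in>T. card (in_nbrs y))"
      by (rule card_UN_le) (simp add: T_def)
    also have "\<dots> \<le> card T * H"
      using sum_bounded_above[of T "\<lambda>y. card (in_nbrs y)" H] by (simp add: T_def low_def)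
    finally have "n \<le> card ?A + card T * (H + 1)" by simp
    also have "card T * (H + 1) \<le> c * (H + 1)" using cT by (intro mult_right_mono) auto
    finally have "Suc c * n \<le> Suc c * (card ?A + c * (H + 1))" by (intro mult_left_mono) simp_all
    also have "\<dots> = Suc c * card ?A + Suc c * (c * (H + 1))" by (simp only: distrib_left)
    finally have "n + c * n < Suc c * card ?A + n" using c_n by simp
    then show ?thesis using M'' c by simp
  qed
  ultimately show thesis by (rule that)
qed

lemma extremal_targets:
  assumes M: "int (card missing) \<le> extremal_missing n r" and n: "4096 * r ^ 8 + 16 * r ^ 2 < n"
  shows "\<exists>a b. int (card missing) = extremal_missing n r \<and>
    missing = far_pairs r V (\<lambda>x. d x a) \<union> far_pairs r V (\<lambda>x. d x b) \<and>
    two_sided r V (\<lambda>x. d x a) (\<lambda>x. d x b) \<and>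
    (\<exists>x\<in>V. d x a = r - 1) \<and> (\<exists>x\<in>V. d x b = r - 1)"
proof -
  obtain T where "layered_digraph V E r T"
    and avoid: "card missing < (2 * r - 2) * card {x \<in> V - T. out_missed x \<supseteq> T}"
    using layered_from_missing[OF M n] .
  then interpret layered_digraph V E r T by simp
  \<comment> \<open>\<open>S\<close> is \<open>T\<close> in the even case. In the uneven case
    \<open>t 1\<close> is removed from \<open>T\<close> to reach size \<open>2 * r - 4\<close>; it
    has distance \<open>r - 2\<close> to \<open>a\<close> and at least \<open>r\<close> to
    \<open>b\<close>.\<close>
  have "\<exists>a b S. a \<in> V \<and> b \<in> V \<and> (\<forall>x\<in>V. r \<le> d x a \<or> r \<le> d x b) \<and> finite S \<and> card S \<le> 2 * r - 4 \<and>
      (\<forall>x\<in>V. d x a + 3 \<le> r \<longrightarrow> x \<in> S) \<and> (\<forall>x\<in>V. d x b + 3 \<le> r \<longrightarrow> x \<in> S)"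
    using avoid
  proof (cases rule: two_chains_cases)
    case (even t s)
    let ?a = "t (r - 2)" and ?b = "s (r - 2)"
    have V: "?a \<in> V" "?b \<in> V" and layer: "layer ?a = r - 2" "layer ?b = r - 2"
      using chain_V chain_layer even(1,2) by auto
    have "r \<le> d x ?a \<or> r \<le> d x ?b" if x: "x \<in> V" for x
    proof -
      obtain y where y: "y \<in> V" "r \<le> d x y" "r - 2 \<le> layer y" using far_layer[OF x] by blast
      then have l: "layer y = r - 2" using even(5)[OF y(1)] by simp
      then have "y \<in> T" using layer_eq_0[OF y(1)] r_ge by auto
      then obtain i where "i \<le> r - 2" "y = t i \<or> y = s i" unfolding even(3) by auto
      then have "y = ?a \<or> y = ?b" using chain_layer[OF even(1)] chain_layer[OF even(2)] l by auto
      then show ?thesis using y by auto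
    qed
    moreover have "x \<in> T" if "x \<in> V" "d x ?a + 3 \<le> r \<or> d x ?b + 3 \<le> r" for x
      using that layer_triangle[OF that(1) V(1)] layer_triangle[OF that(1) V(2)] layer
        layer_eq_0[OF that(1)] r_ge by (cases "x \<in> T") auto
    ultimately show ?thesis using V even(4) by (intro exI[of _ ?a] exI[of _ ?b] exI[of _ T]) auto
  next
    case (uneven t s)
    interpret uneven_layered_digraph V E r T t s
      using uneven by unfold_locales auto
    have cover: "\<forall>x\<in>V. r \<le> d x a \<or> r \<le> d x b"
      using uncovered_missing M by (meson not_le)
    have t1: "t 1 \<in> T" using chain_T[OF t_chain, of 1] r_ge by simp
    then have "card (T - {t 1}) \<le> 2 * r - 4" using cT by simp
    moreover have "x \<in> T - {t 1}" if x: "x \<in> V" "d x a + 3 \<le> r" for x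
    proof -
      have "2 \<le> layer x" using layer_triangle[OF x(1) ab_V(1)] t_layer[of "r - 1"] x r_ge by simp
      then show ?thesis using layer_eq_0[OF x(1)] t_layer[of 1] r_ge by auto
    qed
    moreover have "x \<in> T - {t 1}" if x: "x \<in> V" "d x b + 3 \<le> r" for x
    proof -
      have "1 \<le> layer x" using layer_triangle[OF x(1) ab_V(3)] s_layer[of "r - 2"] x r_ge by simp
      moreover have "r \<le> d (t 1) b" by (rule t_b) (use r_ge in linarith)
      then have "x \<noteq> t 1" using x by auto
      ultimately show ?thesis using layer_eq_0[OF x(1)] by auto
    qed
    ultimately show ?thesis using ab_V cover
      by (intro exI[of _ a] exI[of _ b] exI[of _ "T - {t 1}"]) auto
  qed
  then obtain a b S where ab: "a \<in> V" "b \<in> V" and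
    S: "\<And>x. x \<in> V \<Longrightarrow> r \<le> d x a \<or> r \<le> d x b" "finite S" "card S \<le> 2 * r - 4"
      "\<And>x. \<lbrakk>x \<in> V; d x a + 3 \<le> r\<rbrakk> \<Longrightarrow> x \<in> S" "\<And>x. \<lbrakk>x \<in> V; d x b + 3 \<le> r\<rbrakk> \<Longrightarrow> x \<in> S"
    by blast
  have "int (card missing) = extremal_missing n r"
    using two_targets(1)[OF ab S] M by simp
  with two_targets(2)[OF ab S M] show ?thesis by blast
qed

end

section \<open>The extremal digraphs\<close>

lemma two_sided_swap: "two_sided r U f g \<Longrightarrow> two_sided r U g f"
  by (auto simp: two_sided_def not_le[symmetric])

lemma card_below:
  assumes "finite U"
  shows "card {x \<in> U. f x < (k::nat)} = (\<Sum>j<k. card {x \<in> U. f x = j})"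
proof -
  have "{x \<in> U. f x < k} = (\<Union>j\<in>{..<k}. {x \<in> U. f x = j})" by auto
  also have "card \<dots> = (\<Sum>j<k. card {x \<in> U. f x = j})"
    using assms by (intro card_UN_disjoint) auto
  finally show ?thesis .
qed

lemma card_two_sided:
  assumes ts: "two_sided r U f g" and r: "1 \<le> r"
  shows "card U = 2 * (r - 1) + card {x \<in> U. f x = r - 1} + card {x \<in> U. g x = r - 1}"
proof -
  have U: "finite U" using ts by (simp add: two_sided_def)
  have *: "card {x \<in> U. h x < r} = (r - 1) + card {x \<in> U. h x = r - 1}"
    if "\<And>j. j + 2 \<le> r \<Longrightarrow> card {x \<in> U. h x = j} = 1" for h
  proof -
    obtain k where k: "r = Suc k" using r by (cases r) auto
    have "(\<Sum>j<k. card {x \<in> U. h x = j}) = k" using that by (simp add: k)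
    then show ?thesis unfolding card_below[OF U] by (simp add: k)
  qed
  have "U = {x \<in> U. f x < r} \<union> {x \<in> U. g x < r}" "{x \<in> U. f x < r} \<inter> {x \<in> U. g x < r} = {}"
    using ts by (auto simp: two_sided_def not_le[symmetric])
  then have "card U = card {x \<in> U. f x < r} + card {x \<in> U. g x < r}"
    using U card_Un_disjoint[of "{x \<in> U. f x < r}" "{x \<in> U. g x < r}"] by simp
  also have "\<dots> = ((r - 1) + card {x \<in> U. f x = r - 1}) + ((r - 1) + card {x \<in> U. g x = r - 1})"
    using ts by (simp add: * two_sided_def)
  finally show ?thesis by simp
qed

text \<open>Exactly one of the two truncated values is below \<open>r\<close>, so every fibre is a
  level of \<open>f\<close>, a level of \<open>g\<close>, or empty.\<close>

lemma two_sided_fibre: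
  assumes "two_sided r U f g"
  shows "card {x \<in> U. (min (f x) r, min (g x) r) = (i, j)} =
    (if j = r \<and> i < r then card {x \<in> U. f x = i}
     else if i = r \<and> j < r then card {x \<in> U. g x = j} else 0)"
proof -
  have pw: "(min (f x) r, min (g x) r) = (i, j) \<longleftrightarrow>
    (if j = r \<and> i < r then f x = i else i = r \<and> j < r \<and> g x = j)" if x: "x \<in> U" for x
  proof (cases "f x < r")
    case True
    then have "min (f x) r = f x" "min (g x) r = r" "\<not> g x < r"
      using assms x by (auto simp: two_sided_def)
    then show ?thesis using True by auto
  next
    case False
    then have "min (f x) r = r" "min (g x) r = g x" "g x < r"
      using assms x by (auto simp: two_sided_def not_le[symmetric])
    then show ?thesis using False by auto
  qed
  have fib: "{x \<in> U. (min (f x) r, min (g x) r) = (i, j)} =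
    {x \<in> U. if j = r \<and> i < r then f x = i else i = r \<and> j < r \<and> g x = j}"
    by (intro Collect_cong conj_cong refl pw)
  consider "j = r \<and> i < r" | "\<not> (j = r \<and> i < r)" "i = r \<and> j < r"
    | "\<not> (j = r \<and> i < r)" "\<not> (i = r \<and> j < r)" by blast
  then show ?thesis
  proof cases
    case 1
    then show ?thesis unfolding fib by (simp only: if_True simp_thms)
  next
    case 2
    then show ?thesis unfolding fib by (simp only: if_True if_False simp_thms)
  next
    case 3
    then have "{x \<in> U. if j = r \<and> i < r then f x = i else i = r \<and> j < r \<and> g x = j} = {}"
      by auto
    then show ?thesis unfolding fib using 3 by (simp only: if_False card.empty)
  qed
qed

text \<open>Bijections between corresponding fibres are glued together.\<close>

lemma bij_of_equal_fibres:
  assumes "finite U" "finite P" and eq: "\<And>c. card {x \<in> U. F x = c} = card {y \<in> P. G y = c}"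
  shows "\<exists>h. bij_betw h U P \<and> (\<forall>x\<in>U. G (h x) = F x)"
proof -
  have "\<exists>h. bij_betw h {x \<in> U. F x = c} {y \<in> P. G y = c}" for c
    using assms by (intro finite_same_card_bij) auto
  then obtain h where h: "\<And>c. bij_betw (h c) {x \<in> U. F x = c} {y \<in> P. G y = c}" by metis
  define k where "k x = h (F x) x" for x
  have kP: "k x \<in> P \<and> G (k x) = F x" if "x \<in> U" for x
    using bij_betwE[OF h[of "F x"]] that by (auto simp: k_def)
  have "inj_on k U"
  proof (rule inj_onI)
    fix x y assume xy: "x \<in> U" "y \<in> U" "k x = k y"
    then have "F x = F y" using kP by metis
    then show "x = y"
      using bij_betw_imp_inj_on[OF h[of "F x"]] xy by (auto simp: k_def dest: inj_onD)
  qed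
  moreover have "k ` U = P"
  proof
    show "k ` U \<subseteq> P" using kP by auto
    show "P \<subseteq> k ` U"
    proof
      fix y assume "y \<in> P"
      then have "y \<in> h (G y) ` {x \<in> U. F x = G y}"
        using bij_betw_imp_surj_on[OF h[of "G y"]] by auto
      then obtain x where "x \<in> U" "F x = G y" "y = h (G y) x" by blast
      then have "y = k x" by (simp add: k_def)
      then show "y \<in> k ` U" using \<open>x \<in> U\<close> by (rule image_eqI)
    qed
  qed
  ultimately show ?thesis using kP by (intro exI[of _ k]) (auto simp: bij_betw_def)
qed

lemma two_sided_bij:
  assumes U: "two_sided r U f g" and P: "two_sided r P f' g'"
    and top: "card {x \<in> U. f x = r - 1} = card {x \<in> P. f' x = r - 1}"
      "card {x \<in> U. g x = r - 1} = card {x \<in> P. g' x = r - 1}"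
  shows "\<exists>h. bij_betw h U P \<and>
    (\<forall>x\<in>U. min (f' (h x)) r = min (f x) r \<and> min (g' (h x)) r = min (g x) r)"
proof -
  have "card {x \<in> U. f x = i} = card {x \<in> P. f' x = i}"
    "card {x \<in> U. g x = i} = card {x \<in> P. g' x = i}" if "i < r" for i
  proof -
    have "i + 2 \<le> r \<or> i = r - 1" using that by linarith
    then show "card {x \<in> U. f x = i} = card {x \<in> P. f' x = i}"
      "card {x \<in> U. g x = i} = card {x \<in> P. g' x = i}"
      using U P top by (auto simp: two_sided_def)
  qed
  then have "card {x \<in> U. (min (f x) r, min (g x) r) = c} =
      card {x \<in> P. (min (f' x) r, min (g' x) r) = c}" for c
    using two_sided_fibre[OF U, of "fst c" "snd c"] two_sided_fibre[OF P, of "fst c" "snd c"]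
    by auto
  then have "\<exists>h. bij_betw h U P \<and>
      (\<forall>x\<in>U. (min (f' (h x)) r, min (g' (h x)) r) = (min (f x) r, min (g x) r))"
    using U P by (intro bij_of_equal_fibres) (auto simp: two_sided_def)
  then show ?thesis by simp
qed

text \<open>Membership depends only on truncated levels, so a bijection that preserves these also
  preserves far pairs.\<close>

lemma mem_far_pairs:
  "(x, z) \<in> far_pairs r U f \<longleftrightarrow> x \<in> U \<and> z \<in> U \<and> min (f z) r + 2 \<le> min (f x) r"
  by (auto simp: far_pairs_def)

text \<open>The distances, truncated at \<open>r\<close>, to the copies of \<open>v\<^sub>r\<close> and \<open>w\<^sub>r\<close>.\<close>

definition left_level :: "nat \<Rightarrow> vertex \<times> nat \<Rightarrow> nat" where
  "left_level r x = (case fst x of V i \<Rightarrow> r - i | W i \<Rightarrow> r)"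

definition right_level :: "nat \<Rightarrow> vertex \<times> nat \<Rightarrow> nat" where
  "right_level r x = (case fst x of V i \<Rightarrow> r | W i \<Rightarrow> r - i)"

text \<open>\<open>sn\<close> gives w_1 at least one copy. For \<open>s \<ge> 1\<close> it follows
  from \<open>s\<close> being at most half of \<open>n - 2 * r + 2\<close>.\<close>

context
  fixes n r s :: nat
  assumes r: "4 \<le> r" and s: "1 \<le> s" and sn: "s + 2 * r \<le> n + 1"
begin

abbreviation "extremal_verts \<equiv> pverts (extremal n r s)"

abbreviation "copies \<equiv> (\<lambda>_. 1)(V 1 := s, W 1 := n - 2 * r + 2 - s)"

lemma pverts_extremal: "extremal_verts = {(x, k). x \<in> V ` {1..r} \<union> W ` {1..r} \<and> k < copies x}"
  by (auto simp: extremal_def blow_up_def base_digraph_def)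

lemma V_mem: "(V i, k) \<in> extremal_verts \<longleftrightarrow> 1 \<le> i \<and> i \<le> r \<and> k < (if i = 1 then s else 1)"
  and W_mem: "(W i, k) \<in> extremal_verts \<longleftrightarrow> 1 \<le> i \<and> i \<le> r \<and> k < (if i = 1 then n - 2 * r + 2 - s else 1)"
  unfolding pverts_extremal by auto

lemma finite_extremal: "finite extremal_verts"
proof -
  have "extremal_verts \<subseteq> (V ` {1..r} \<union> W ` {1..r}) \<times> {..<n + 1}"
    unfolding pverts_extremal using s sn by (auto split: if_splits)
  then show ?thesis by (rule finite_subset) simp
qed

lemma left_fibre: "j < r \<Longrightarrow> {x \<in> extremal_verts. left_level r x = j} = Pair (V (r - j)) ` {..<if j = r - 1 then s else 1}"
  and right_fibre: "j < r \<Longrightarrow> {x \<in> extremal_verts. right_level r x = j} =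
    Pair (W (r - j)) ` {..<if j = r - 1 then n - 2 * r + 2 - s else 1}"
proof -
  assume j: "j < r"
  have "x \<in> {x \<in> extremal_verts. left_level r x = j} \<longleftrightarrow> x \<in> Pair (V (r - j)) ` {..<if j = r - 1 then s else 1}" for x
  proof (cases x)
    case (Pair y k)
    then show ?thesis using j r
      by (cases y) (auto simp: V_mem W_mem left_level_def image_iff)
  qed
  then show "{x \<in> extremal_verts. left_level r x = j} = Pair (V (r - j)) ` {..<if j = r - 1 then s else 1}" by blast
  have "x \<in> {x \<in> extremal_verts. right_level r x = j} \<longleftrightarrow>
      x \<in> Pair (W (r - j)) ` {..<if j = r - 1 then n - 2 * r + 2 - s else 1}" for x
  proof (cases x)
    case (Pair y k)
    then show ?thesis using j r
      by (cases y) (auto simp: V_mem W_mem right_level_def image_iff)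
  qed
  then show "{x \<in> extremal_verts. right_level r x = j} =
    Pair (W (r - j)) ` {..<if j = r - 1 then n - 2 * r + 2 - s else 1}" by blast
qed

lemma card_left_fibre: "j < r \<Longrightarrow> card {x \<in> extremal_verts. left_level r x = j} = (if j = r - 1 then s else 1)"
  and card_right_fibre: "j < r \<Longrightarrow> card {x \<in> extremal_verts. right_level r x = j} =
    (if j = r - 1 then n - 2 * r + 2 - s else 1)"
  by (simp_all add: left_fibre right_fibre card_image inj_on_def)

lemma two_sided_extremal: "two_sided r extremal_verts (left_level r) (right_level r)"
proof -
  have "left_level r x < r \<longleftrightarrow> r \<le> right_level r x" if "x \<in> extremal_verts" for x
  proof (cases x)
    case (Pair y k)
    then show ?thesis using that
      by (cases y) (auto simp: V_mem W_mem left_level_def right_level_def)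
  qed
  then show ?thesis
    using finite_extremal card_left_fibre card_right_fibre by (auto simp: two_sided_def)
qed

lemma card_pverts_extremal: "card extremal_verts = n"
proof -
  have "card {x \<in> extremal_verts. left_level r x = r - 1} = s"
    "card {x \<in> extremal_verts. right_level r x = r - 1} = n - 2 * r + 2 - s"
    using card_left_fibre[of "r - 1"] card_right_fibre[of "r - 1"] r by simp_all
  then show ?thesis using card_two_sided[OF two_sided_extremal] r s sn by linarith
qed

text \<open>This puts D_{n,r,s} into the form of the equality case of \<open>two_targets\<close>.
  Arcs within a side raise the index, so lower the level, by at most 1; a vertex of the other side
  has level \<open>r\<close>, so its arcs across reach exactly the clique at level
  \<open>r - 1\<close>.\<close>

lemma parcs_extremal: "parcs (extremal n r s) = {(x, z). x \<in> extremal_verts \<and> z \<in> extremal_verts \<and> x \<noteq> z} -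
  (far_pairs r extremal_verts (left_level r) \<union> far_pairs r extremal_verts (right_level r))"
proof -
  have "(x, z) \<in> parcs (extremal n r s) \<longleftrightarrow> x \<in> extremal_verts \<and> z \<in> extremal_verts \<and> x \<noteq> z \<and>
    \<not> (left_level r z + 2 \<le> left_level r x \<and> left_level r z + 2 \<le> r) \<and>
    \<not> (right_level r z + 2 \<le> right_level r x \<and> right_level r z + 2 \<le> r)" for x z
  proof -
    obtain y k y' l where xz: "x = (y, k)" "z = (y', l)" by (cases x, cases z)
    have arc: "((y, k), (y', l)) \<in> parcs (extremal n r s) \<longleftrightarrow>
       (y, k) \<in> extremal_verts \<and> (y', l) \<in> extremal_verts \<and> ((y, y') \<in> parcs (base_digraph r) \<or> y = y' \<and> k \<noteq> l)"
      by (auto simp: extremal_def blow_up_def)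
    show ?thesis unfolding xz arc
      using r by (cases y; cases y')
        (auto simp: V_mem W_mem left_level_def right_level_def base_digraph_def split: if_splits)
  qed
  then show ?thesis by (auto simp: far_pairs_def)
qed

end

section \<open>Size of digraphs of given outradius\<close>

text \<open>Level \<open>r - 2\<close> is a singleton on both sides and the vertices far from one
  target are those near the other, so the correction terms of \<open>two_targets\<close>
  vanish.\<close>

lemma card_far_pairs_two_sided:
  assumes ts: "two_sided r U f g" and r: "4 \<le> r"
  shows "int (card (far_pairs r U f \<union> far_pairs r U g)) = extremal_missing (card U) r"
proof -
  have U: "finite U" using ts by (simp add: two_sided_def)
  have lev: "card {x \<in> U. f x = j} = 1" "card {x \<in> U. g x = j} = 1" if "j + 2 \<le> r" for j
    using ts that by (auto simp: two_sided_def)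
  have "(h x + 2 = r) = (h x = r - 2)" for h :: "'a \<Rightarrow> nat" and x using r by auto
  then have pq: "card {x \<in> U. f x + 2 = r} = 1" "card {x \<in> U. g x + 2 = r} = 1"
    using lev[of "r - 2"] r by simp_all
  have "U = {x \<in> U. r \<le> f x} \<union> {x \<in> U. r \<le> g x}" "{x \<in> U. r \<le> f x} \<inter> {x \<in> U. r \<le> g x} = {}"
    using ts by (auto simp: two_sided_def not_le[symmetric])
  then have e: "card U = card {x \<in> U. r \<le> f x} + card {x \<in> U. r \<le> g x}"
    using U card_Un_disjoint[of "{x \<in> U. r \<le> f x}" "{x \<in> U. r \<le> g x}"] by simp
  have "far_pairs r U f \<inter> far_pairs r U g = {}"
    using ts by (fastforce simp: far_pairs_def two_sided_def)
  then have "card (far_pairs r U f \<union> far_pairs r U g) = card (far_pairs r U f) + card (far_pairs r U g)"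
    using U by (simp add: card_Un_disjoint)
  moreover note card_far_pairs[OF U r, of f] card_far_pairs[OF U r, of g]
  ultimately show ?thesis
    using lev pq e by (simp add: extremal_missing_def algebra_simps)
qed

lemma card_off_diagonal:
  assumes "finite U"
  shows "int (card {(x, z). x \<in> U \<and> z \<in> U \<and> x \<noteq> z}) = int (card U) * (int (card U) - 1)"
proof -
  let ?O = "{(x, z). x \<in> U \<and> z \<in> U \<and> x \<noteq> z}" and ?D = "(\<lambda>x. (x, x)) ` U"
  have eq: "U \<times> U = ?O \<union> ?D" and dis: "?O \<inter> ?D = {}" by auto
  have "finite ?O" by (rule finite_subset[of _ "U \<times> U"]) (use assms in auto)
  then have "card (U \<times> U) = card ?O + card ?D"
    unfolding eq using dis assms by (intro card_Un_disjoint) auto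
  moreover have "card ?D = card U" by (rule card_image) (simp add: inj_on_def)
  ultimately have "int (card U * card U) = int (card ?O) + int (card U)"
    by (simp add: card_cartesian_product)
  then show ?thesis by (simp add: algebra_simps)
qed

lemma card_parcs_extremal:
  assumes "4 \<le> r" "1 \<le> s" "s + 2 * r \<le> n + 1"
  shows "int (card (parcs (extremal n r s))) = int n * (int n - 1) - extremal_missing n r"
proof -
  let ?P = "pverts (extremal n r s)"
  let ?F = "far_pairs r ?P (left_level r) \<union> far_pairs r ?P (right_level r)"
  let ?O = "{(x, z). x \<in> ?P \<and> z \<in> ?P \<and> x \<noteq> z}"
  have fin: "finite ?P" by (rule finite_extremal[OF assms])
  have "?F \<subseteq> ?O" by (auto simp: far_pairs_def)
  moreover have "finite ?O" by (rule finite_subset[of _ "?P \<times> ?P"]) (use fin in auto)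
  moreover have "finite ?F" using fin by simp
  ultimately have "int (card (?O - ?F)) = int (card ?O) - int (card ?F)"
    by (simp add: card_Diff_subset of_nat_diff card_mono)
  then show ?thesis
    unfolding parcs_extremal[OF assms] card_off_diagonal[OF fin]
      card_far_pairs_two_sided[OF two_sided_extremal[OF assms] assms(1)] card_pverts_extremal[OF assms] .
qed

lemma extremal_size: "int n * (int n - 1) - extremal_missing n r = (int n - (int r - 1))\<^sup>2 + (int r - 3)"
  by (simp add: extremal_missing_def power2_eq_square algebra_simps)

section \<open>Transfer to digraphs of the graph library\<close>

context digraph
begin

lemma relpow_awalk:
  "\<lbrakk>(u, v) \<in> arcs_ends G ^^ k; u \<in> verts G\<rbrakk> \<Longrightarrow> \<exists>p. awalk u p v \<and> length p = k"
proof (induction k arbitrary: u)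
  case 0
  then show ?case by (intro exI[of _ "[]"]) (simp add: awalk_Nil_iff)
next
  case (Suc k)
  obtain w where w: "(u, w) \<in> arcs_ends G" "(w, v) \<in> arcs_ends G ^^ k"
    using relpow_Suc_D2[OF Suc.prems(1)] by blast
  then obtain e where e: "e \<in> arcs G" "u = tail G e" "w = head G e"
    by (auto simp: arcs_ends_conv)
  then obtain p where "awalk w p v" "length p = k" using Suc.IH[OF w(2)] by auto
  then show ?case using e by (intro exI[of _ "e # p"]) (simp add: awalk_Cons_iff)
qed

text \<open>The direction that carries a lower bound on the outradius over to
  \<open>gdist\<close>.\<close>

lemma distance_le_gdist:
  assumes "(u, v) \<in> (arcs_ends G)\<^sup>*" "u \<in> verts G"
  shows "distance G u v \<le> ereal (real (gdist (arcs_ends G) u v))"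
proof -
  obtain p where p: "awalk u p v" "length p = gdist (arcs_ends G) u v"
    using relpow_awalk[OF relpow_gdist[OF assms(1)] assms(2)] by blast
  have "awalk_cost (\<lambda>_. 1) p = real (length p)"
    by (induction p) auto
  then show ?thesis
    using min_cost_le_walk_cost[OF p(1), of "\<lambda>_. 1"] p(2) by (simp add: distance_def)
qed

lemma eccentric_digraph:
  assumes sc: "strongly_connected G" and out: "outradius G = ereal (real r)" and r: "4 \<le> r"
  shows "eccentric_digraph (verts G) (arcs_ends G) r"
proof
  show "finite (verts G)" by simp
  show "arcs_ends G \<subseteq> verts G \<times> verts G" by (auto simp: arcs_ends_conv)
  show "(x, x) \<notin> arcs_ends G" for x using no_loops by (auto simp: arcs_ends_conv)
  show "(x, y) \<in> (arcs_ends G)\<^sup>*" if "x \<in> verts G" "y \<in> verts G" for x y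
  proof -
    have "x \<rightarrow>\<^sup>* y" using sc that by (auto simp: strongly_connected_def)
    then show ?thesis by (rule reachable_rtranclI)
  qed
  then have conn: "(x, y) \<in> (arcs_ends G)\<^sup>*" if "x \<in> verts G" "y \<in> verts G" for x y
    using that .
  show "\<exists>y\<in>verts G. r \<le> gdist (arcs_ends G) x y" if x: "x \<in> verts G" for x
  proof -
    have "ereal (real r) \<le> (SUP y\<in>verts G. distance G x y)"
      unfolding out[symmetric] outradius_def using x by (rule INF_lower)
    \<comment> \<open>By finiteness the supremum is attained, which provides the far vertex.\<close>
    moreover have "Max (distance G x ` verts G) = (SUP y\<in>verts G. distance G x y)"
      using x by (intro Max_Sup) auto
    moreover have "Max (distance G x ` verts G) \<in> distance G x ` verts G"
      using x by (intro Max_in) auto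
    ultimately obtain y where y: "y \<in> verts G" "ereal (real r) \<le> distance G x y" by force
    then have "ereal (real r) \<le> ereal (real (gdist (arcs_ends G) x y))"
      using distance_le_gdist[OF conn[OF x y(1)] x] by (rule_tac order_trans)
    then show ?thesis using y(1) by auto
  qed
  show "4 \<le> r" by (rule r)
qed

lemma card_arcs_ends: "card (arcs_ends G) = card (arcs G)"
  unfolding arcs_ends_def by (rule card_image) (auto intro!: inj_onI no_multi_arcs)

text \<open>The sizes of the two levels \<open>r - 1\<close> are the only free parameters, and they
  match the two cliques. A bijection preserving truncated levels then preserves the nonarcs.\<close>

lemma iso_extremal:
  assumes ts: "two_sided r (verts G) f g" and r: "4 \<le> r"
    and arcs: "arcs_ends G = {(x, z). x \<in> verts G \<and> z \<in> verts G \<and> x \<noteq> z}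
      - (far_pairs r (verts G) f \<union> far_pairs r (verts G) g)"
    and s: "s = card {x \<in> verts G. f x = r - 1}" "1 \<le> s" "s \<le> card {x \<in> verts G. g x = r - 1}"
    and n: "n = card (verts G)"
  shows "real s \<le> (real n - 2 * real r + 2) / 2 \<and> digraph_iso G (with_proj (extremal n r s))"
proof -
  define t where "t = card {x \<in> verts G. g x = r - 1}"
  have nst: "n = 2 * (r - 1) + s + t"
    using card_two_sided[OF ts] r by (simp add: n s(1) t_def)
  have sn: "s + 2 * r \<le> n + 1" using nst s r unfolding t_def[symmetric] by linarith
  let ?P = "pverts (extremal n r s)"
  note ext = r s(2) sn
  have "t = n - 2 * r + 2 - s"
    using nst r s(2,3) unfolding t_def[symmetric] by linarith
  then have "\<exists>h. bij_betw h (verts G) ?P \<and> (\<forall>x\<in>verts G.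
      min (left_level r (h x)) r = min (f x) r \<and> min (right_level r (h x)) r = min (g x) r)"
    using card_left_fibre[OF ext, of "r - 1"] card_right_fibre[OF ext, of "r - 1"] r s(1)
    by (intro two_sided_bij[OF ts two_sided_extremal[OF ext]]) (auto simp: t_def)
  then obtain h where h: "bij_betw h (verts G) ?P"
    and lev: "\<And>x. x \<in> verts G \<Longrightarrow> min (left_level r (h x)) r = min (f x) r"
      "\<And>x. x \<in> verts G \<Longrightarrow> min (right_level r (h x)) r = min (g x) r"
    by blast
  have inj: "inj_on h (verts G)" and img: "h ` verts G = ?P" using h by (auto simp: bij_betw_def)
  have arc_iff: "(x, z) \<in> arcs_ends G \<longleftrightarrow> (h x, h z) \<in> parcs (extremal n r s)"
    if "x \<in> verts G" "z \<in> verts G" for x z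
  proof -
    have "h x \<in> ?P" "h z \<in> ?P" using img that by auto
    moreover from this have "(h x, h z) \<in> far_pairs r ?P (left_level r) \<longleftrightarrow> (x, z) \<in> far_pairs r (verts G) f"
      "(h x, h z) \<in> far_pairs r ?P (right_level r) \<longleftrightarrow> (x, z) \<in> far_pairs r (verts G) g"
      using that lev by (simp_all only: mem_far_pairs simp_thms)
    moreover have "h x = h z \<longleftrightarrow> x = z" using inj that by (auto dest: inj_onD)
    ultimately show ?thesis unfolding arcs parcs_extremal[OF ext] using that by simp
  qed
  \<comment> \<open>In \<open>with_proj\<close> an arc is its own pair of ends, so an arc is mapped
    to the images of its ends.\<close>
  define iso where "iso = \<lparr> iso_verts = h, iso_arcs = (\<lambda>e. (h (tail G e), h (head G e))),
    iso_head = snd, iso_tail = fst \<rparr>"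
  have "inj_on (\<lambda>e. (h (tail G e), h (head G e))) (arcs G)"
  proof (rule inj_onI)
    fix e e' assume e: "e \<in> arcs G" "e' \<in> arcs G"
      "(h (tail G e), h (head G e)) = (h (tail G e'), h (head G e'))"
    then have "tail G e = tail G e'" "head G e = head G e'"
      using inj by (auto dest: inj_onD)
    then show "e = e'" using e no_multi_arcs by (simp add: arc_to_ends_def)
  qed
  then have 1: "digraph_isomorphism iso"
    using inj wf_digraph_axioms by (simp add: digraph_isomorphism_def iso_def)
  have "(\<lambda>e. (h (tail G e), h (head G e))) ` arcs G = parcs (extremal n r s)"
  proof
    show "(\<lambda>e. (h (tail G e), h (head G e))) ` arcs G \<subseteq> parcs (extremal n r s)"
    proof (rule image_subsetI)
      fix e assume "e \<in> arcs G"
      then show "(h (tail G e), h (head G e)) \<in> parcs (extremal n r s)"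
        using arc_iff[of "tail G e" "head G e"] by (simp add: arcs_ends_conv)
    qed
    show "parcs (extremal n r s) \<subseteq> (\<lambda>e. (h (tail G e), h (head G e))) ` arcs G"
    proof
      fix w assume w: "w \<in> parcs (extremal n r s)"
      then obtain y z where yz: "w = (y, z)" "y \<in> ?P" "z \<in> ?P"
        unfolding parcs_extremal[OF ext] by auto
      then obtain u v where uv: "u \<in> verts G" "v \<in> verts G" "y = h u" "z = h v"
        using yz(2,3) unfolding img[symmetric] by blast
      then have "(u, v) \<in> arcs_ends G" using w arc_iff yz by simp
      then show "w \<in> (\<lambda>e. (h (tail G e), h (head G e))) ` arcs G"
        using yz uv by (auto simp: arcs_ends_conv)
    qed
  qed
  then have "with_proj (extremal n r s) = app_iso iso G"
    using img by (simp add: app_iso_def with_proj_def iso_def)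
  with 1 have "digraph_iso G (with_proj (extremal n r s))"
    unfolding digraph_iso_def by blast
  moreover have "real s \<le> (real n - 2 * real r + 2) / 2"
  proof -
    have "2 * s + 2 * r \<le> n + 2" using nst s r unfolding t_def[symmetric] by linarith
    then have "real (2 * s + 2 * r) \<le> real (n + 2)" by (simp only: of_nat_le_iff)
    then show ?thesis by simp
  qed
  ultimately show ?thesis by blast
qed

lemma size_le_extremal:
  assumes sc: "strongly_connected G" and out: "outradius G = ereal (real r)" and r: "4 \<le> r"
    and n: "card (verts G) = n" "4096 * r ^ 8 + 16 * r ^ 2 < n"
  shows "int (card (arcs G)) \<le> int n * (int n - 1) - extremal_missing n r"
    and "int (card (arcs G)) = int n * (int n - 1) - extremal_missing n r \<Longrightarrow>
      \<exists>s\<ge>1. real s \<le> (real n - 2 * real r + 2) / 2 \<and> digraph_iso G (with_proj (extremal n r s))"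
proof -
  interpret E: eccentric_digraph "verts G" "arcs_ends G" r
    by (rule eccentric_digraph[OF sc out r])
  let ?O = "{(x, z). x \<in> verts G \<and> z \<in> verts G \<and> x \<noteq> z}"
  have "?O = E.missing \<union> arcs_ends G" "E.missing \<inter> arcs_ends G = {}"
    using E.EV E.irrefl by (auto simp: E.missing_def)
  moreover have "finite (arcs_ends G)" by (simp add: arcs_ends_def)
  ultimately have "card ?O = card E.missing + card (arcs_ends G)"
    by (simp add: card_Un_disjoint)
  then have cM: "int (card (arcs G)) = int n * (int n - 1) - int (card E.missing)"
    using card_off_diagonal[of "verts G"] n by (simp add: card_arcs_ends)
  note targets = E.extremal_targets[unfolded n(1), OF _ n(2)]
  show "int (card (arcs G)) \<le> int n * (int n - 1) - extremal_missing n r"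
  proof (rule ccontr)
    assume "\<not> ?thesis"
    then have "int (card E.missing) < extremal_missing n r" using cM by simp
    then show False using targets by auto
  qed
  assume "int (card (arcs G)) = int n * (int n - 1) - extremal_missing n r"
  then have "int (card E.missing) \<le> extremal_missing n r" using cM by simp
  then obtain a b where
      miss: "E.missing = far_pairs r (verts G) (\<lambda>x. E.d x a) \<union> far_pairs r (verts G) (\<lambda>x. E.d x b)"
    and ts: "two_sided r (verts G) (\<lambda>x. E.d x a) (\<lambda>x. E.d x b)"
    and top: "\<exists>x\<in>verts G. E.d x a = r - 1" "\<exists>x\<in>verts G. E.d x b = r - 1"
    using targets by blast
  have arcs: "arcs_ends G = ?O - E.missing"
    using E.EV E.irrefl by (auto simp: E.missing_def)
  define sa where "sa = card {x \<in> verts G. E.d x a = r - 1}"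
  define sb where "sb = card {x \<in> verts G. E.d x b = r - 1}"
  have pos: "1 \<le> sa" "1 \<le> sb"
    using top by (auto simp: sa_def sb_def Suc_le_eq card_gt_0_iff)
  show "\<exists>s\<ge>1. real s \<le> (real n - 2 * real r + 2) / 2 \<and> digraph_iso G (with_proj (extremal n r s))"
  \<comment> \<open>The targets are exchanged if necessary, so that \<open>s\<close> is the size of
    the smaller clique.\<close>
  proof (cases "sa \<le> sb")
    case True
    then show ?thesis
      using iso_extremal[OF ts r arcs[unfolded miss] sa_def pos(1) _ n(1)[symmetric]] pos
      unfolding sb_def by blast
  next
    case False
    then have "sb \<le> card {x \<in> verts G. E.d x a = r - 1}" by (simp add: sa_def)
    then show ?thesis
      using iso_extremal[OF two_sided_swap[OF ts] r arcs[unfolded miss Un_commute[of "far_pairs r (verts G) (\<lambda>x. E.d x a)"]]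
          sb_def pos(2) _ n(1)[symmetric]] pos by blast
  qed
qed

end

lemma digraph_iso_card_arcs:
  assumes "digraph_iso G H"
  shows "card (arcs H) = card (arcs G)"
proof -
  obtain iso where "pre_digraph.digraph_isomorphism G iso" "H = app_iso iso G"
    using assms unfolding digraph_iso_def by blast
  then show ?thesis
    by (simp add: card_image pre_digraph.digraph_isomorphism_def)
qed

theorem theorem4p4:
  fixes r :: nat
  assumes "r \<ge> 4"
  shows "\<exists>n\<^sub>1 :: nat. \<forall>n > n\<^sub>1.
    int (card (parcs (extremal n r 1))) = (int n - (int r - 1))^2 + (int r - 3) \<and>
    (\<forall>D :: ('a, 'b) pre_digraph.
      digraph D \<and> strongly_connected D \<and> card (verts D) = n \<and> outradius D = ereal (real r) \<longrightarrow>
        card (arcs D) \<le> card (parcs (extremal n r 1)) \<and>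
        (card (arcs D) = card (parcs (extremal n r 1)) \<longleftrightarrow>
          (\<exists>s :: nat. 1 \<le> s \<and> real s \<le> (real n - 2 * real r + 2) / 2 \<and>
            digraph_iso D (with_proj (extremal n r s)))))"
proof (intro exI[of _ "4096 * r ^ 8 + 16 * r ^ 2"] allI impI conjI)
  fix n :: nat
  assume n: "4096 * r ^ 8 + 16 * r ^ 2 < n"
  have "r \<le> r ^ 2" by (rule self_le_power) (use assms in auto)
  then have nr: "2 * r < n" using n by linarith
  \<comment> \<open>All admissible \<open>s\<close> give the same number of arcs; this settles the
    converse in the case of equality.\<close>
  have size: "int (card (parcs (extremal n r s))) = int n * (int n - 1) - extremal_missing n r"
    if "1 \<le> s" "real s \<le> (real n - 2 * real r + 2) / 2" for s
  proof (rule card_parcs_extremal[OF assms that(1)])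
    show "s + 2 * r \<le> n + 1" proof -
      have "real (2 * s + 2 * r) \<le> real (n + 2)" using that(2) by simp
      then have "2 * s + 2 * r \<le> n + 2" by (simp only: of_nat_le_iff)
      then show ?thesis using that(1) by linarith
    qed
  qed
  have size1: "int (card (parcs (extremal n r 1))) = int n * (int n - 1) - extremal_missing n r"
    by (rule size) (use nr in auto)
  then show "int (card (parcs (extremal n r 1))) = (int n - (int r - 1))\<^sup>2 + (int r - 3)"
    by (simp only: extremal_size)
  fix D :: "('a, 'b) pre_digraph"
  assume D: "digraph D \<and> strongly_connected D \<and> card (verts D) = n \<and> outradius D = ereal (real r)"
  then interpret digraph D by simp
  note bound = size_le_extremal[OF _ _ assms _ n]
  show "card (arcs D) \<le> card (parcs (extremal n r 1))"
    using bound(1) D size1 by simp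
  show "card (arcs D) = card (parcs (extremal n r 1)) \<longleftrightarrow>
          (\<exists>s :: nat. 1 \<le> s \<and> real s \<le> (real n - 2 * real r + 2) / 2 \<and>
            digraph_iso D (with_proj (extremal n r s)))"
  proof
    assume "card (arcs D) = card (parcs (extremal n r 1))"
    then show "\<exists>s :: nat. 1 \<le> s \<and> real s \<le> (real n - 2 * real r + 2) / 2 \<and>
            digraph_iso D (with_proj (extremal n r s))"
      using bound(2) D size1 by simp
  next
    assume "\<exists>s :: nat. 1 \<le> s \<and> real s \<le> (real n - 2 * real r + 2) / 2 \<and>
            digraph_iso D (with_proj (extremal n r s))"
    then obtain s :: nat where s: "1 \<le> s" "real s \<le> (real n - 2 * real r + 2) / 2"
      "digraph_iso D (with_proj (extremal n r s))" by blast
    then show "card (arcs D) = card (parcs (extremal n r 1))"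
      using digraph_iso_card_arcs[OF s(3)] size[OF s(1,2)] size1 by simp
  qed
qed

end
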